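(* Let $q\neq 2$ be a prime power and let $D,N$ be integers with $N>2D\geq 6$. Let $\Gamma=(X,\mathcal R)$ be the bilinear forms graph $H_q(D,N-D)$, let $E$ be the primitive idempotent associated with the second largest eigenvalue $\theta_1$, and let $\star$ be the Norton algebra product on $EV$. Fix $x,y\in X$ with $2\leq \partial(x,y)\leq D-1$. Let $n\geq 1$ be an integer and for $1\leq i\leq n$ let $z_i,\mathsf z_i$ be a permutation of $x,y$ (i.e. $\{z_i,\mathsf z_i\}=\{x,y\}$). Then \[ E\hat z_1\star(E\hat z_2\star(E\hat z_3\star\cdots\star(E\hat z_{n-1}\star E\hat z_n)\cdots)) - E\hat{\mathsf z}_1\star(E\hat{\mathsf z}_2\star(E\hat{\mathsf z}_3\star\cdots\star(E\hat{\mathsf z}_{n-1}\star E\hat{\mathsf z}_n)\cdots)) \in \mathrm{Span}\{E\hat x-E\hat y\}. \] (For $n=1$ the expressions are $E\hat z_1$ and $E\hat{\mathsf z}_1$.)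
   Context: The bilinear forms graph $H_q(D,N-D)$: the vertex set $X$ is the set of all $D\times(N-D)$ matrices over $\mathrm{GF}(q)$, two vertices adjacent iff their difference has rank one; $\partial$ is the path-length distance (the graph has diameter $D$). $V=\mathbb R^X$ with $\langle u,v\rangle=u^tv$; $\hat x$ is the standard basis vector for $x\in X$. $A$ is the adjacency matrix with eigenvalues $\theta_0>\theta_1>\cdots>\theta_D$; $E$ is the primitive idempotent (orthogonal projection onto the $\theta_1$-eigenspace $EV$). For $u=\sum_x u_x\hat x$, $v=\sum_x v_x\hat x$, the entrywise product is $u\circ v=\sum_x u_xv_x\hat x$, and the Norton algebra product on $EV$ is $u\star v=E(u\circ v)$. *)

theory Defs
  imports "HOL-Analysis.Analysis"
begin

section \<open>Spectral notions for a graph on a finite vertex type\<close>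

text \<open>
  A graph is given by its adjacency relation on a finite type of vertices \<open>'v\<close>; the
  standard module is the Euclidean space \<open>real ^ 'v\<close>.
\<close>

definition adj_matrix :: "('v::finite \<Rightarrow> 'v \<Rightarrow> bool) \<Rightarrow> real ^ 'v ^ 'v" where
  "adj_matrix R = (\<chi> x y. if R x y then 1 else 0)"

text \<open>
  Length of a shortest path, i.e. the least \<open>k\<close> such that \<open>k\<close> steps along edges lead from
  \<open>x\<close> to \<open>y\<close>. The value is meaningful only if \<open>y\<close> can be reached from \<open>x\<close>,
  so the notion is intended for connected graphs.
\<close>

definition graph_dist :: "('v \<Rightarrow> 'v \<Rightarrow> bool) \<Rightarrow> 'v \<Rightarrow> 'v \<Rightarrow> nat" where
  "graph_dist R x y = (LEAST k. (R ^^ k) x y)"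

definition eigenspace :: "real ^ 'v ^ 'v \<Rightarrow> real \<Rightarrow> (real ^ 'v) set" where
  "eigenspace M \<theta> = {v. M *v v = \<theta> *\<^sub>R v}"

definition eigenvalues :: "real ^ 'v ^ 'v \<Rightarrow> real set" where
  "eigenvalues M = {\<theta>. \<exists>v. v \<noteq> 0 \<and> M *v v = \<theta> *\<^sub>R v}"

text \<open>
  The eigenvalue \<open>\<theta>\<^sub>1\<close> in the list \<open>\<theta>\<^sub>0 > \<theta>\<^sub>1 > \<dots>\<close> of the
  \<^emph>\<open>distinct\<close> eigenvalues; multiplicities play no role.
\<close>

definition second_largest_eigenvalue :: "real ^ 'v ^ 'v \<Rightarrow> real" where
  "second_largest_eigenvalue M = Max (eigenvalues M - {Max (eigenvalues M)})"

definition orth_proj :: "(real ^ 'v) set \<Rightarrow> real ^ 'v ^ 'v::finite" where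
  "orth_proj W = (THE P. \<forall>v. P *v v \<in> W \<and> v - P *v v \<in> orthogonal_comp W)"

lemma orth_proj_eqI:
  assumes "subspace W" and P: "\<And>v. P *v v \<in> W \<and> v - P *v v \<in> orthogonal_comp W"
  shows "orth_proj W = P"
  unfolding orth_proj_def
proof (rule the_equality)
  show "\<forall>v. P *v v \<in> W \<and> v - P *v v \<in> orthogonal_comp W"
    using P by blast
next
  fix Q assume Q: "\<forall>v. Q *v v \<in> W \<and> v - Q *v v \<in> orthogonal_comp W"
  have "Q *v v = P *v v" for v
  proof -
    have "Q *v v - P *v v \<in> W"
      using P Q \<open>subspace W\<close> by (simp add: subspace_diff)
    moreover have "(v - P *v v) - (v - Q *v v) \<in> orthogonal_comp W"
      using P Q subspace_orthogonal_comp subspace_diff by blast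
    then have "Q *v v - P *v v \<in> orthogonal_comp W" by simp
    ultimately have "orthogonal (Q *v v - P *v v) (Q *v v - P *v v)"
      by (auto simp: orthogonal_comp_def)
    then show ?thesis by (simp add: orthogonal_def)
  qed
  then show "Q = P" by (simp add: matrix_eq)
qed

lemma orth_proj:
  fixes W :: "(real ^ 'v::finite) set"
  assumes "subspace W"
  shows "orth_proj W *v v \<in> W" and "v - orth_proj W *v v \<in> orthogonal_comp W"
proof -
  have "\<exists>w. w \<in> W \<and> u - w \<in> orthogonal_comp W" for u
  proof -
    obtain y z where "y \<in> span W" "\<And>w. w \<in> span W \<Longrightarrow> orthogonal z w" "u = y + z"
      using orthogonal_subspace_decomp_exists by blast
    moreover have "span W = W" using assms by simp
    ultimately show ?thesis
      by (intro exI[of _ y]) (auto simp: orthogonal_comp_def orthogonal_commute)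
  qed
  then obtain f where f: "\<And>u. f u \<in> W \<and> u - f u \<in> orthogonal_comp W"
    by metis
  have uniq: "a = f u" if "a \<in> W" "u - a \<in> orthogonal_comp W" for a u
  proof -
    have "a - f u \<in> W" using that f assms by (simp add: subspace_diff)
    moreover have "(u - f u) - (u - a) \<in> orthogonal_comp W"
      using f that subspace_orthogonal_comp subspace_diff by blast
    then have "a - f u \<in> orthogonal_comp W" by simp
    ultimately have "orthogonal (a - f u) (a - f u)"
      by (auto simp: orthogonal_comp_def)
    then show ?thesis by (simp add: orthogonal_def)
  qed
  have "linear f"
  proof (rule linearI)
    fix a b
    have "f a + f b \<in> W" using f assms by (simp add: subspace_add)
    moreover have "(a - f a) + (b - f b) \<in> orthogonal_comp W"
      using f subspace_orthogonal_comp subspace_add by blast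
    ultimately show "f (a + b) = f a + f b"
      using uniq[of "f a + f b" "a + b"] by (simp add: algebra_simps)
  next
    fix c a
    have "c *\<^sub>R f a \<in> W" using f assms by (simp add: subspace_scale)
    moreover have "c *\<^sub>R (a - f a) \<in> orthogonal_comp W"
      using f subspace_orthogonal_comp subspace_scale by blast
    ultimately show "f (c *\<^sub>R a) = c *\<^sub>R f a"
      using uniq[of "c *\<^sub>R f a" "c *\<^sub>R a"] by (simp add: algebra_simps)
  qed
  then have "matrix f *v u = f u" for u by (simp add: matrix_works)
  then have "orth_proj W = matrix f"
    using f assms by (intro orth_proj_eqI) auto
  with f \<open>\<And>u. matrix f *v u = f u\<close>
  show "orth_proj W *v v \<in> W" "v - orth_proj W *v v \<in> orthogonal_comp W"
    by auto
qed

section \<open>Norton product\<close>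

text \<open>
  Multiplication on \<open>real ^ 'v\<close> is the entrywise product. For arguments in the column
  space of \<open>E\<close> this is the Norton product.
\<close>

definition norton :: "real ^ 'v ^ 'v \<Rightarrow> real ^ 'v \<Rightarrow> real ^ 'v \<Rightarrow> real ^ 'v::finite" where
  "norton E u v = E *v (u * v)"

abbreviation hat :: "'v \<Rightarrow> real ^ 'v::finite" where
  "hat x \<equiv> axis x 1"

text \<open>
  The right-nested product of \<open>E *v hat (z 1), \<dots>, E *v hat (z n)\<close>; for \<open>n = 1\<close>
  it is \<open>E *v hat (z 1)\<close>. It is not meant to be used with \<open>n = 0\<close>.
\<close>

definition norton_nested :: "real ^ 'v ^ 'v \<Rightarrow> (nat \<Rightarrow> 'v) \<Rightarrow> nat \<Rightarrow> real ^ 'v::finite" where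
  "norton_nested E z n = foldr (\<lambda>i u. norton E (E *v hat (z i)) u) [1..<n] (E *v hat (z n))"

section \<open>The bilinear forms graph\<close>

text \<open>
  The vertices of \<open>H\<^sub>q(D, N - D)\<close> are all elements of the type \<open>'a ^ 'm ^ 'd\<close>, i.e. the
  matrices with rows indexed by \<open>'d\<close> and columns by \<open>'m\<close>, over the finite field \<open>'a\<close>, where
  \<open>CARD('a) = q\<close>, \<open>CARD('d) = D\<close> and \<open>CARD('m) = N - D\<close>. The graph is connected.
\<close>

definition bilin_adj :: "'a::{field,finite} ^ 'm ^ 'd \<Rightarrow> 'a ^ 'm ^ 'd \<Rightarrow> bool" where
  "bilin_adj x y \<longleftrightarrow> rank (x - y) = 1"

definition bilin_E :: "real ^ ('a::{field,finite} ^ 'm ^ 'd) ^ ('a ^ 'm ^ 'd)" where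
  "bilin_E = (let A = adj_matrix bilin_adj
    in orth_proj (eigenspace A (second_largest_eigenvalue A)))"

end

theory Submission
  imports Defs "HOL-Number_Theory.Cong"
begin

text \<open>
  Fix a nontrivial additive character \<open>\<psi>\<close> of the field. The functions
  \<open>z \<mapsto> \<psi> (tr (B\<^sup>T z))\<close> diagonalise the adjacency matrix; the eigenvalue depends
  only on the size of the left kernel of \<open>B\<close>, is largest for \<open>B = 0\<close> and second largest exactly
  for \<open>B\<close> of rank one. Hence on the Fourier side \<open>E\<close> restricts to frequencies of rank one, and
  the Norton product is a convolution restricted to them. Put \<open>d = y - x\<close>, and for
  \<open>B = u v\<^sup>T\<close> consider the functions \<open>1\<close>, \<open>\<psi> (- tr (B\<^sup>T d))\<close>, \<open>[d v = 0]\<close>,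
  \<open>[u\<^sup>T d = 0]\<close> and \<open>[u\<^sup>T d v = 0]\<close>, each multiplied by
  \<open>\<psi> (- tr (B\<^sup>T x))\<close>; the first two are the transforms of \<open>E x\<close> and
  \<open>E y\<close>. Since \<open>B\<close>, \<open>C\<close> and \<open>B - C\<close> can all have rank one only if \<open>C\<close> shares the
  row or the column space of \<open>B\<close>, counting shows that multiplication by \<open>E x\<close> or \<open>E y\<close>
  preserves their span. Exchanging \<open>x\<close> and \<open>y\<close> swaps the first two functions and fixes the
  others, so the two nested products differ by a multiple of \<open>E x - E y\<close>.
\<close>

section \<open>Additive characters of finite fields\<close>

text \<open>With p the characteristic, the additive group has a subgroup \<open>H\<close> of index p
  that avoids 1 and so complements the prime field. The character raises a primitive p-th root of
  unity to the prime-field component of its argument.\<close>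

lemma nontrivial_additive_character:
  obtains \<psi> :: "'a::{field,finite} \<Rightarrow> complex"
  where "\<And>a b. \<psi> (a + b) = \<psi> a * \<psi> b" and "\<exists>a. \<psi> a \<noteq> 1" and "\<psi> 0 = 1"
proof -
  define p where "p = CHAR('a)"
  have "p > 0" unfolding p_def by (rule finite_imp_CHAR_pos) simp
  then have "prime p" unfolding p_def by (rule prime_CHAR_semidom)
  \<comment> \<open>An additive subgroup maximal subject to not containing 1 has index \<open>p\<close>, and the
    multiples of 1 represent its cosets.\<close>
  define sg where "sg H \<longleftrightarrow> 0 \<in> H \<and> (\<forall>a\<in>H. \<forall>b\<in>H. a + b \<in> H) \<and> 1 \<notin> H" for H :: "'a set"
  have "sg {0}" by (simp add: sg_def)
  then have "{H. sg H} \<noteq> {}" by blast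
  then obtain H where H: "sg H" and Hmax: "\<And>H'. sg H' \<Longrightarrow> H \<subseteq> H' \<Longrightarrow> H' = H"
    using finite_has_maximal[of "{H. sg H}"] by auto
  have H0: "0 \<in> H" and Hadd: "\<And>a b. a \<in> H \<Longrightarrow> b \<in> H \<Longrightarrow> a + b \<in> H" and H1: "1 \<notin> H"
    using H by (auto simp: sg_def)
  have Hmult: "of_nat k * a \<in> H" if "a \<in> H" for k a
    by (induction k) (use that H0 Hadd in \<open>auto simp: algebra_simps\<close>)
  have Hneg: "- a \<in> H" if "a \<in> H" for a
  proof -
    \<comment> \<open>In characteristic p negation is repeated addition, so closure under addition
      already makes \<open>H\<close> a subgroup.\<close>
    have "of_nat (p - 1) * a = - a"
      using \<open>p > 0\<close> by (simp add: of_nat_diff p_def)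
    then show ?thesis using Hmult[OF that, of "p - 1"] by simp
  qed
  have Hdiff: "a - b \<in> H" if "a \<in> H" "b \<in> H" for a b
    using Hadd[OF that(1) Hneg[OF that(2)]] by simp
  have inv: "\<exists>m. of_nat m * of_nat j = (1::'a)" if "\<not> p dvd j" for j
  proof -
    have "coprime j p" using \<open>prime p\<close> that by (metis prime_imp_coprime coprime_commute)
    then obtain m where "[j * m = Suc 0] (mod p)" using cong_solve_coprime_nat by blast
    then have "(of_nat (j * m) :: 'a) = of_nat (Suc 0)" unfolding p_def of_nat_eq_iff_cong_CHAR .
    then show ?thesis by (intro exI[of _ m]) (simp add: mult.commute)
  qed
  have ex: "\<exists>k. a - of_nat k \<in> H" for a
  proof (cases "a \<in> H")
    case True then show ?thesis by (intro exI[of _ 0]) simp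
  next
    case False
    \<comment> \<open>\<open>H'\<close> is generated by \<open>H\<close> and \<open>a\<close>, so by
      maximality it contains 1. In \<open>1 = h + of_nat j * a\<close> the number j is prime to p,
      since otherwise 1 would lie in \<open>H\<close>; multiplying by an inverse m of j puts
      \<open>a\<close> into the coset of \<open>of_nat m\<close>.\<close>
    define H' where "H' = {h + of_nat j * a | h j. h \<in> H}"
    have HH: "H \<subseteq> H'" unfolding H'_def by (force intro: exI[of _ 0])
    have aH: "a \<in> H'" unfolding H'_def using H0 by (force intro: exI[of _ "Suc 0"] exI[of _ 0])
    have "h + of_nat i * a + (h' + of_nat j * a) = (h + h') + of_nat (i + j) * a" for h h' i j
      by (simp add: algebra_simps)
    then have "b + c \<in> H'" if "b \<in> H'" "c \<in> H'" for b c
      using that Hadd unfolding H'_def by (smt (verit) mem_Collect_eq)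
    then have "1 \<in> H'" using Hmax[of H'] HH aH False H0 by (auto simp: sg_def)
    then obtain h j where h: "h \<in> H" "1 = h + of_nat j * a" unfolding H'_def by blast
    have "\<not> p dvd j"
    proof
      assume "p dvd j"
      then have "(of_nat j :: 'a) = 0" by (simp add: p_def of_nat_eq_0_iff_char_dvd)
      with h H1 show False by simp
    qed
    then obtain m where m: "of_nat m * of_nat j = (1::'a)" using inv by blast
    have "a - of_nat m = of_nat m * of_nat j * a - of_nat m * (h + of_nat j * a)"
      using m h(2) by simp
    also have "\<dots> = - (of_nat m * h)" by (simp add: algebra_simps)
    finally show ?thesis using Hneg Hmult h(1) by metis
  qed
  then obtain k where k: "\<And>a. a - of_nat (k a) \<in> H" by metis
  have uniq0: "i mod p = j mod p" if "a - of_nat i \<in> H" "a - of_nat j \<in> H" "i \<le> j" for a i j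
  proof (rule ccontr)
    \<comment> \<open>Otherwise \<open>of_nat (j - i)\<close> would lie in \<open>H\<close> and have
      1 among its multiples.\<close>
    assume "i mod p \<noteq> j mod p"
    then have "\<not> p dvd j - i" using that(3) by (metis mod_eq_dvd_iff_nat)
    then obtain m where m: "of_nat m * of_nat (j - i) = (1::'a)" using inv by blast
    have "of_nat (j - i) = (a - of_nat i) - (a - of_nat j)" using that(3) by (simp add: of_nat_diff)
    then have "of_nat (j - i) \<in> H" using Hdiff that by metis
    from Hmult[OF this, of m] m H1 show False by simp
  qed
  have uniq: "i mod p = j mod p" if "a - of_nat i \<in> H" "a - of_nat j \<in> H" for a i j
    using uniq0[OF that] uniq0[OF that(2,1)] by (metis nat_le_linear)
  define \<omega> where "\<omega> = cis (2 * pi / real p)"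
  have "\<omega> ^ p = 1" using \<open>p > 0\<close> by (simp add: \<omega>_def Complex.DeMoivre)
  then have wmod: "\<omega> ^ i = \<omega> ^ (i mod p)" for i
  proof -
    have "\<omega> ^ i = \<omega> ^ (p * (i div p) + i mod p)" by simp
    also have "\<dots> = \<omega> ^ (i mod p)" by (simp only: power_add power_mult \<open>\<omega> ^ p = 1\<close>) simp
    finally show ?thesis .
  qed
  have "\<omega> \<noteq> 1"
  proof
    assume "\<omega> = 1"
    then have "cos (2 * pi / real p) = 1" by (simp add: \<omega>_def complex_eq_iff)
    then obtain n :: int where n: "2 * pi / real p = of_int n * 2 * pi"
      using cos_one_2pi_int by blast
    then have "1 = of_int n * real p" using \<open>p > 0\<close> by (simp add: field_simps)
    then have "1 = n * int p" by (metis of_int_1 of_int_eq_iff of_int_mult of_int_of_nat_eq)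
    then have "int p dvd 1" by (metis dvd_triv_right)
    with \<open>prime p\<close> show False by auto
  qed
  show thesis
  proof (rule that[of "\<lambda>a. \<omega> ^ k a"])
    fix a b
    have "(a + b) - of_nat (k a + k b) = (a - of_nat (k a)) + (b - of_nat (k b))" by simp
    then have "(a + b) - of_nat (k a + k b) \<in> H" using Hadd k by metis
    then have "k (a + b) mod p = (k a + k b) mod p" using uniq k by blast
    then show "\<omega> ^ k (a + b) = \<omega> ^ k a * \<omega> ^ k b" by (metis wmod power_add)
  next
    have "k 1 mod p = 1 mod p" using uniq[OF k, of 1 1] H0 by simp
    then have "\<omega> ^ k 1 = \<omega> ^ 1" by (metis wmod)
    with \<open>\<omega> \<noteq> 1\<close> show "\<exists>a. \<omega> ^ k a \<noteq> 1" by (intro exI[of _ 1]) simp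
  next
    have "k 0 mod p = 0 mod p" using uniq[OF k, of 0 0] H0 by simp
    then show "\<omega> ^ k 0 = 1" by (metis wmod mod_0 power_0)
  qed
qed

section \<open>Matrices of rank one\<close>

definition vdot :: "'a::comm_semiring_0 ^ 'n::finite \<Rightarrow> 'a ^ 'n \<Rightarrow> 'a" where
  "vdot u v = (\<Sum>i\<in>UNIV. u $ i * v $ i)"

text \<open>The trace form tr(B^T C); composed with \<open>\<psi>\<close> it indexes the characters
  of the matrix space by matrices.\<close>

definition mdot :: "'a::comm_semiring_0 ^ 'm::finite ^ 'd::finite \<Rightarrow> 'a ^ 'm ^ 'd \<Rightarrow> 'a" where
  "mdot B C = (\<Sum>i\<in>UNIV. vdot (B $ i) (C $ i))"

definition outer :: "'a::times ^ 'd \<Rightarrow> 'a ^ 'm \<Rightarrow> 'a ^ 'm ^ 'd" where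
  "outer u v = (\<chi> i j. u $ i * v $ j)"

definition rank_one :: "('a::field ^ 'm::finite ^ 'd::finite) set" where
  "rank_one = {outer u v | u v. u \<noteq> 0 \<and> v \<noteq> 0}"

lemma vdot_zero [simp]: "vdot 0 v = 0" "vdot v 0 = 0"
  by (simp_all add: vdot_def)

lemma vdot_commute: "vdot u v = vdot v u"
  by (simp add: vdot_def mult.commute)

lemma vdot_add: "vdot (u + v) w = vdot u w + vdot v w"
  by (simp add: vdot_def distrib_right sum.distrib)

lemma vdot_scale: "vdot (c *s u) v = c * vdot u v"
  by (simp add: vdot_def sum_distrib_left mult.assoc)

lemma vdot_axis: "vdot (axis i c) v = c * v $ i"
  by (simp add: vdot_def axis_def if_distrib[of "\<lambda>x. x * _"] cong: if_cong)

lemma mdot_zero [simp]: "mdot 0 C = 0" "mdot C 0 = 0"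
  by (simp_all add: mdot_def)

lemma mdot_commute: "mdot B C = mdot C B"
  by (simp add: mdot_def vdot_commute)

lemma mdot_add_left: "mdot (B + C) D = mdot B D + mdot C D"
  by (simp add: mdot_def vdot_add sum.distrib)

lemma mdot_minus_left: "mdot (- B) C = - mdot B C"
  for B C :: "'a::comm_ring_1 ^ 'm::finite ^ 'd::finite"
  by (simp add: mdot_def vdot_def sum_negf)

lemma mdot_minus_right: "mdot C (- B) = - mdot C B"
  for B C :: "'a::comm_ring_1 ^ 'm::finite ^ 'd::finite"
  using mdot_minus_left[of B C] by (simp add: mdot_commute)

lemma mdot_diff_left: "mdot (B - C) D = mdot B D - mdot C D"
  for B C D :: "'a::comm_ring_1 ^ 'm::finite ^ 'd::finite"
  using mdot_add_left[of B "- C" D] by (simp add: mdot_minus_left)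

lemma mdot_diff_right: "mdot D (B - C) = mdot D B - mdot D C"
  for B C D :: "'a::comm_ring_1 ^ 'm::finite ^ 'd::finite"
  using mdot_diff_left[of B C D] by (simp add: mdot_commute)

lemma mdot_outer: "mdot (outer u v) C = vdot u (C *v v)"
  by (simp add: mdot_def vdot_def outer_def matrix_vector_mult_def sum_distrib_left ac_simps)

text \<open>Counterpart of \<open>mdot_outer\<close> that exhibits the value as linear in
  \<open>v\<close> instead of \<open>u\<close>; each form serves the sums in which that factor
  varies.\<close>

lemma mdot_outer': "mdot (outer u v) C = vdot v (u v* C)"
proof -
  have "mdot (outer u v) C = (\<Sum>i\<in>UNIV. \<Sum>j\<in>UNIV. v $ j * (u $ i * C $ i $ j))"
    by (simp add: mdot_def vdot_def outer_def mult.assoc mult.left_commute)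
  also have "\<dots> = (\<Sum>j\<in>UNIV. \<Sum>i\<in>UNIV. v $ j * (u $ i * C $ i $ j))" by (rule sum.swap)
  also have "\<dots> = vdot v (u v* C)"
    by (simp add: vdot_def vector_matrix_mult_def sum_distrib_left mult.commute mult.left_commute)
  finally show ?thesis .
qed

lemma outer_eq_0_iff: "outer u v = 0 \<longleftrightarrow> u = 0 \<or> v = 0"
  for u :: "'a::field ^ 'd" and v :: "'a ^ 'm"
  by (auto simp: outer_def vec_eq_iff)

lemma outer_diff_left: "outer (u - u') v = outer u v - outer u' v"
  for u :: "'a::field ^ 'd" and v :: "'a ^ 'm"
  by (simp add: outer_def vec_eq_iff algebra_simps)

lemma outer_diff_right: "outer u (v - v') = outer u v - outer u v'"
  for u :: "'a::field ^ 'd" and v :: "'a ^ 'm"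
  by (simp add: outer_def vec_eq_iff algebra_simps)

lemma outer_scale: "outer (c *s u) v = outer u (c *s v)"
  for u :: "'a::field ^ 'd" and v :: "'a ^ 'm"
  by (simp add: outer_def vec_eq_iff algebra_simps)

lemma outer_vm: "t v* outer u v = vdot t u *s v"
  for u :: "'a::field ^ 'd::finite" and v :: "'a ^ 'm::finite"
  by (simp add: outer_def vec_eq_iff vector_matrix_mult_def vdot_def sum_distrib_left ac_simps)

lemma outer_mv: "outer u v *v t = vdot v t *s u"
  for u :: "'a::field ^ 'd::finite" and v :: "'a ^ 'm::finite"
  by (simp add: outer_def vec_eq_iff matrix_vector_mult_def vdot_def sum_distrib_left ac_simps)

text \<open>For nonzero \<open>a\<close> the functional is the 2x2 minor
  \<open>a $ i * c $ j - a $ j * c $ i\<close>, taken at coordinates where \<open>b\<close> fails to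
  be proportional to \<open>a\<close>.\<close>

lemma annihilator_not_subset:
  fixes a b :: "'a::field ^ 'n::finite"
  assumes "\<And>c. b \<noteq> c *s a"
  obtains t where "vdot t a = 0" "vdot t b \<noteq> 0"
proof (cases "a = 0")
  case True
  with assms[of 0] obtain i where "b $ i \<noteq> 0" by (auto simp: vec_eq_iff)
  then show thesis using True that[of "axis i 1"] by (simp add: vdot_axis)
next
  case False
  then obtain i where i: "a $ i \<noteq> 0" by (auto simp: vec_eq_iff)
  obtain j where j: "b $ j \<noteq> b $ i / a $ i * a $ j"
    using assms[of "b $ i / a $ i"] by (auto simp: vec_eq_iff)
  have eq: "vdot (axis j (a $ i) + axis i (- a $ j)) c = a $ i * c $ j - a $ j * c $ i" for c
    by (simp only: vdot_add vdot_axis) simp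
  show thesis
  proof (rule that)
    show "vdot (axis j (a $ i) + axis i (- a $ j)) a = 0" unfolding eq by simp
    show "vdot (axis j (a $ i) + axis i (- a $ j)) b \<noteq> 0"
      unfolding eq using i j by (auto simp: field_simps)
  qed
qed

text \<open>The row space is a line: \<open>v\<close> spans it, and the entries of \<open>u\<close>
  are the coefficients of the individual rows.\<close>

lemma rank_eq_1_iff: "rank B = 1 \<longleftrightarrow> B \<in> rank_one"
  for B :: "'a::field ^ 'm::finite ^ 'd::finite"
proof
  assume "rank B = 1"
  then have dim: "vec.dim (rows B) = 1" by (simp add: row_rank_def_gen)
  obtain S where S: "S \<subseteq> rows B" "vec.independent S" "rows B \<subseteq> vec.span S" "card S = 1"
    using vec.basis_exists[of "rows B"] dim by metis
  then obtain v where v: "S = {v}" using card_1_singletonE by blast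
  have "v \<noteq> 0" using S(2) v vec.dependent_zero by blast
  have "\<exists>c. row i B = c *s v" for i
    using S(3) v by (auto simp: rows_def vec.span_singleton)
  then obtain u where u: "\<And>i. row i B = u i *s v" by metis
  have B: "B = outer (\<chi> i. u i) v"
    using u by (simp add: outer_def vec_eq_iff row_def)
  obtain i where "v = row i B" using S(1) v by (auto simp: rows_def)
  with u[of i] \<open>v \<noteq> 0\<close> have "u i \<noteq> 0" by auto
  then have "(\<chi> i. u i) \<noteq> 0" by (auto simp: vec_eq_iff)
  with B \<open>v \<noteq> 0\<close> show "B \<in> rank_one" unfolding rank_one_def by blast
next
  assume "B \<in> rank_one"
  then obtain u v where uv: "B = outer u v" "u \<noteq> 0" "v \<noteq> 0" by (auto simp: rank_one_def)
  have row: "row i B = u $ i *s v" for i by (simp add: uv(1) row_def outer_def vec_eq_iff)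
  obtain i where i: "u $ i \<noteq> 0" using uv(2) by (auto simp: vec_eq_iff)
  have "rows B \<subseteq> vec.span {v}" by (auto simp: rows_def row vec.span_singleton)
  moreover have "{v} \<subseteq> vec.span (rows B)"
  proof -
    have "row i B \<in> vec.span (rows B)" by (intro vec.span_base) (auto simp: rows_def)
    then have "inverse (u $ i) *s row i B \<in> vec.span (rows B)" by (rule vec.span_scale)
    then show ?thesis using i by (simp add: row)
  qed
  ultimately have "vec.span (rows B) = vec.span {v}"
    by (metis vec.span_mono vec.span_span subset_antisym)
  then have "vec.dim (rows B) = vec.dim {v}" by (metis vec.dim_span)
  then show "rank B = 1" using uv(3) by (simp add: row_rank_def_gen)
qed

lemma bilin_adj_iff: "bilin_adj x y \<longleftrightarrow> x - y \<in> rank_one"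
  unfolding bilin_adj_def rank_eq_1_iff ..

lemma zero_not_rank_one: "0 \<notin> rank_one"
  using outer_eq_0_iff by (force simp: rank_one_def)

lemma outer_uminus: "outer (- u) v = - outer u v"
  for u :: "'a::field ^ 'd" and v :: "'a ^ 'm"
  by (simp add: outer_def vec_eq_iff)

lemma rank_one_uminus: "- B \<in> rank_one \<longleftrightarrow> B \<in> rank_one"
proof -
  have "- B \<in> rank_one" if "B \<in> rank_one" for B :: "'a ^ 'm ^ 'd"
    using that unfolding rank_one_def by (smt (verit) mem_Collect_eq neg_equal_0_iff_equal outer_uminus)
  from this[of B] this[of "- B"] show ?thesis by auto
qed

text \<open>A column with \<open>v $ j \<noteq> 0\<close> shows that \<open>u\<close> is a multiple
  of \<open>u'\<close>; cancelling a nonzero entry of \<open>u'\<close> then fixes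
  \<open>v\<close>.\<close>

lemma outer_eq_outerD:
  fixes u :: "'a::field ^ 'd::finite" and v :: "'a ^ 'm::finite"
  assumes "outer u v = outer u' v'" "u' \<noteq> 0" "v' \<noteq> 0"
  obtains c where "c \<noteq> 0" "u = c *s u'" "v = inverse c *s v'"
proof -
  have nz: "u \<noteq> 0" "v \<noteq> 0" using assms by (metis outer_eq_0_iff)+
  then obtain j where j: "v $ j \<noteq> 0" by (auto simp: vec_eq_iff)
  define c where "c = v' $ j / v $ j"
  have "u $ i * v $ j = u' $ i * v' $ j" for i
    using assms(1) by (simp add: outer_def vec_eq_iff)
  then have u: "u = c *s u'" using j by (simp add: c_def vec_eq_iff field_simps)
  with nz have c: "c \<noteq> 0" by auto
  obtain i where i: "u' $ i \<noteq> 0" using assms(2) by (auto simp: vec_eq_iff)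
  have "outer u v $ i $ k = outer u' v' $ i $ k" for k using assms(1) by simp
  then have "u' $ i * (c * v $ k) = u' $ i * v' $ k" for k
    by (simp add: outer_def u mult.assoc mult.left_commute[of c] del: mult_cancel_left)
  then have "c * v $ k = v' $ k" for k using i by simp
  then have "v = inverse c *s v'" using c by (simp add: vec_eq_iff field_simps)
  with c u that show thesis by blast
qed

lemma rank_one_diff_iff:
  fixes u :: "'a::field ^ 'd::finite" and v :: "'a ^ 'm::finite"
  assumes u: "u \<noteq> 0" and v: "v \<noteq> 0"
  shows "C \<in> rank_one \<and> outer u v - C \<in> rank_one \<longleftrightarrow>
         (\<exists>u'. C = outer u' v \<and> u' \<noteq> 0 \<and> u' \<noteq> u) \<or> (\<exists>v'. C = outer u v' \<and> v' \<noteq> 0 \<and> v' \<noteq> v)"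
    (is "?L \<longleftrightarrow> ?R")
proof
  assume ?L
  then obtain u1 v1 u2 v2 where C: "C = outer u1 v1" and D: "outer u v - C = outer u2 v2"
    and nz: "u1 \<noteq> 0" "v1 \<noteq> 0" "u2 \<noteq> 0" "v2 \<noteq> 0" by (auto simp: rank_one_def)
  have sum: "outer u v = outer u1 v1 + outer u2 v2" using C D by (simp add: algebra_simps)
  have CB: "C \<noteq> outer u v" using D nz by (metis outer_eq_0_iff right_minus_eq)
  show ?R
  proof (cases "\<exists>c. v1 = c *s v")
    case True
    then obtain c where "v1 = c *s v" by blast
    then have "C = outer (c *s u1) v" by (simp add: C outer_scale)
    moreover have "c *s u1 \<noteq> 0" using \<open>v1 = c *s v\<close> nz by auto
    ultimately show ?thesis using CB by blast
  next
    case False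
    \<comment> \<open>Applying both sides to \<open>t\<close> kills \<open>outer u v\<close> but not
      \<open>C\<close>, so \<open>u1\<close> and \<open>u2\<close> are parallel. The sum then has
      column space spanned by \<open>u1\<close>, which must be that of \<open>u\<close>.\<close>
    then obtain t where t: "vdot t v = 0" "vdot t v1 \<noteq> 0" using annihilator_not_subset by metis
    have "outer u v *v t = outer u1 v1 *v t + outer u2 v2 *v t"
      by (simp add: sum matrix_vector_mult_add_rdistrib)
    then have e: "vdot v1 t *s u1 = - (vdot v2 t *s u2)"
      using t by (simp add: outer_mv vdot_commute eq_neg_iff_add_eq_0)
    have v1t: "vdot v1 t \<noteq> 0" using t by (simp add: vdot_commute)
    define m where "m = - vdot v2 t / vdot v1 t"
    have u1: "u1 = m *s u2"
    proof -
      have "vdot v1 t * u1 $ i = - (vdot v2 t * u2 $ i)" for i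
        using e by (simp add: vec_eq_iff)
      then show ?thesis using v1t by (simp add: m_def vec_eq_iff field_simps)
    qed
    then have m: "m \<noteq> 0" using nz by auto
    have u2: "u2 = inverse m *s u1" using m by (simp add: u1 vec_eq_iff)
    have "outer u v = outer u1 (v1 + inverse m *s v2)"
      unfolding sum by (subst u2) (simp add: outer_def vec_eq_iff algebra_simps)
    then obtain c where c: "c \<noteq> 0" "u1 = c *s u" 
      using outer_eq_outerD[of u1 "v1 + inverse m *s v2" u v] u v by metis
    then have "C = outer u (c *s v1)" by (simp add: C outer_scale)
    moreover have "c *s v1 \<noteq> 0" using c nz by auto
    ultimately show ?thesis using CB by blast
  qed
next
  assume ?R
  then show ?L
  proof
    assume "\<exists>u'. C = outer u' v \<and> u' \<noteq> 0 \<and> u' \<noteq> u"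
    then obtain u' where u': "C = outer u' v" "u' \<noteq> 0" "u' \<noteq> u" by blast
    then have "outer u v - C = outer (u - u') v" by (simp add: outer_diff_left)
    with u' v show ?L unfolding rank_one_def by (metis (mono_tags, lifting) mem_Collect_eq right_minus_eq)
  next
    assume "\<exists>v'. C = outer u v' \<and> v' \<noteq> 0 \<and> v' \<noteq> v"
    then obtain v' where v': "C = outer u v'" "v' \<noteq> 0" "v' \<noteq> v" by blast
    then have "outer u v - C = outer u (v - v')" by (simp add: outer_diff_right)
    with v' u show ?L unfolding rank_one_def by (metis (mono_tags, lifting) mem_Collect_eq right_minus_eq)
  qed
qed

section \<open>Fourier transform on matrices\<close>

text \<open>Translating the summation variable by \<open>t\<close> multiplies the sum by
  \<open>h t\<close>.\<close>

lemma sum_multiplicative_eq_0: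
  fixes h :: "'v::{ab_group_add,finite} \<Rightarrow> complex"
  assumes add: "\<And>u v. h (u + v) = h u * h v" and t: "h t \<noteq> 1"
  shows "(\<Sum>u\<in>UNIV. h u) = 0"
proof -
  have "(\<Sum>u\<in>UNIV. h u) = (\<Sum>u\<in>UNIV. h (u + t))"
    by (rule sum.reindex_bij_witness[of _ "\<lambda>u. u + t" "\<lambda>u. u - t"]) auto
  also have "\<dots> = (\<Sum>u\<in>UNIV. h u) * h t" by (simp add: add sum_distrib_right)
  finally show ?thesis using t by simp
qed

text \<open>The fibre over a rank-one matrix consists of the pairs
  \<open>(c *s u, inverse c *s v)\<close> with \<open>c\<close> nonzero.\<close>

lemma sum_outer_nonzero:
  fixes f :: "'a::{field,finite} ^ 'm::finite ^ 'd::finite \<Rightarrow> complex"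
  shows "(\<Sum>u\<in>-{0}. \<Sum>v\<in>-{0}. f (outer u v)) = of_nat (CARD('a) - 1) * (\<Sum>C\<in>rank_one. f C)"
proof -
  let ?P = "(-{0}) \<times> (-{0}) :: (('a ^ 'd) \<times> ('a ^ 'm)) set" and ?o = "\<lambda>(u, v). outer u v"
  have img: "?o ` ?P = rank_one" by (auto simp: rank_one_def image_iff)
  have card: "card {p \<in> ?P. ?o p = C} = CARD('a) - 1" if C: "C \<in> rank_one" for C :: "'a ^ 'm ^ 'd"
  proof -
    obtain u v where uv: "C = outer u v" "u \<noteq> 0" "v \<noteq> 0" using C by (auto simp: rank_one_def)
    let ?g = "\<lambda>c. (c *s u, inverse c *s v)"
    have "{p \<in> ?P. ?o p = C} = ?g ` (-{0})"
    proof (intro equalityI subsetI)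
      fix p assume "p \<in> {p \<in> ?P. ?o p = C}"
      then obtain u' v' where p: "p = (u', v')" and "outer u' v' = outer u v" using uv by auto
      then obtain c where "c \<noteq> 0" "u' = c *s u" "v' = inverse c *s v"
        using outer_eq_outerD uv by metis
      then show "p \<in> ?g ` (-{0})" using p by blast
    next
      fix p assume "p \<in> ?g ` (-{0})"
      then obtain c where c: "c \<noteq> 0" "p = (c *s u, inverse c *s v)" by blast
      have "outer (c *s u) (inverse c *s v) = outer u v"
        using c by (simp add: outer_def vec_eq_iff)
      then show "p \<in> {p \<in> ?P. ?o p = C}" using c uv by simp
    qed
    moreover have "inj_on ?g (-{0})"
      using uv(2) by (auto intro!: inj_onI)
    ultimately show ?thesis by (simp add: card_image Compl_eq_Diff_UNIV card_Diff_subset)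
  qed
  have "(\<Sum>u\<in>-{0}. \<Sum>v\<in>-{0}. f (outer u v)) = (\<Sum>p\<in>?P. f (?o p))"
    by (simp add: sum.cartesian_product split_def)
  also have "\<dots> = (\<Sum>C\<in>?o ` ?P. \<Sum>p\<in>{p \<in> ?P. ?o p = C}. f (?o p))"
    by (rule sum.image_gen) simp
  also have "\<dots> = (\<Sum>C\<in>rank_one. of_nat (CARD('a) - 1) * f C)"
    unfolding img
  proof (rule sum.cong[OF refl])
    fix C :: "'a ^ 'm ^ 'd" assume C: "C \<in> rank_one"
    have "(\<Sum>p\<in>{p \<in> ?P. ?o p = C}. f (?o p)) = (\<Sum>p\<in>{p \<in> ?P. ?o p = C}. f C)"
      by (rule sum.cong) auto
    also have "\<dots> = of_nat (CARD('a) - 1) * f C" by (simp only: sum_constant card[OF C])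
    finally show "(\<Sum>p\<in>{p \<in> ?P. ?o p = C}. f (?o p)) = of_nat (CARD('a) - 1) * f C" .
  qed
  finally show ?thesis by (simp add: sum_distrib_left)
qed

lemma CARD_field_ge_2: "CARD('a::{field,finite}) \<ge> 2"
proof -
  have "card {0, 1 :: 'a} \<le> CARD('a)" by (rule card_mono) auto
  then show ?thesis by simp
qed

locale nontrivial_character =
  fixes \<psi> :: "'a::{field,finite} \<Rightarrow> complex"
  assumes add: "\<psi> (a + b) = \<psi> a * \<psi> b"
    and zero [simp]: "\<psi> 0 = 1"
    and nontrivial: "\<exists>a. \<psi> a \<noteq> 1"
begin

lemma diff: "\<psi> (a - b) = \<psi> a * \<psi> (- b)"
  using add[of a "- b"] by simp

section \<open>Orthogonality of characters and the size of hyperplanes\<close>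

lemma sum_scalar: "(\<Sum>c\<in>UNIV. \<psi> (c * a)) = of_nat CARD('a) * of_bool (a = 0)"
proof (cases "a = 0")
  case False
  obtain b where "\<psi> b \<noteq> 1" using nontrivial by blast
  then have "(\<Sum>c\<in>UNIV. \<psi> (c * a)) = 0"
    using False by (intro sum_multiplicative_eq_0[where t = "b / a"]) (simp_all add: distrib_right add)
  then show ?thesis using False by simp
qed simp

lemma sum_vdot:
  "(\<Sum>u\<in>UNIV. \<psi> (vdot u a)) = of_nat CARD('a ^ 'n) * of_bool (a = 0)"
  for a :: "'a ^ 'n::finite"
proof (cases "a = 0")
  case False
  then obtain i where i: "a $ i \<noteq> 0" by (auto simp: vec_eq_iff)
  obtain b where "\<psi> b \<noteq> 1" using nontrivial by blast
  then have "(\<Sum>u\<in>UNIV. \<psi> (vdot u a)) = 0"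
    using i by (intro sum_multiplicative_eq_0[where t = "axis i (b / a $ i)"])
      (simp_all add: vdot_add add vdot_axis)
  then show ?thesis using False by simp
qed simp

lemma sum_mdot:
  "(\<Sum>B\<in>UNIV. \<psi> (mdot B C)) = of_nat CARD('a ^ 'm ^ 'd) * of_bool (C = 0)"
  for C :: "'a ^ 'm::finite ^ 'd::finite"
proof (cases "C = 0")
  case False
  then obtain i j where i: "C $ i $ j \<noteq> 0" by (auto simp: vec_eq_iff)
  obtain b where "\<psi> b \<noteq> 1" using nontrivial by blast
  moreover have "(C *v axis j 1) $ i = C $ i $ j"
    by (simp add: matrix_vector_mult_def axis_def if_distrib[of "\<lambda>x. _ * x"] cong: if_cong)
  \<comment> \<open>The translation used is a matrix with one nonzero entry, scaled so that its
    pairing with \<open>C\<close> is \<open>b\<close>.\<close>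
  ultimately have "\<psi> (mdot (outer (axis i (b / C $ i $ j)) (axis j 1)) C) \<noteq> 1"
    using i by (simp add: mdot_outer vdot_axis)
  then have "(\<Sum>B\<in>UNIV. \<psi> (mdot B C)) = 0"
    by (intro sum_multiplicative_eq_0) (simp_all add: mdot_add_left add)
  then show ?thesis using False by simp
qed simp

text \<open>The indicator of the hyperplane, times q, is a sum of characters over the multiples
  \<open>c *s a\<close>. After exchanging the sums only \<open>c = 0\<close> contributes.\<close>

lemma card_hyperplane:
  fixes a :: "'a ^ 'n::finite"
  assumes "a \<noteq> 0"
  shows "CARD('a) * card {u. vdot u a = 0} = CARD('a ^ 'n)"
proof -
  have "of_nat (CARD('a) * card {u. vdot u a = 0}) = (\<Sum>u\<in>UNIV. of_nat CARD('a) * of_bool (vdot u a = 0) :: complex)"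
    by (simp add: sum_distrib_left[symmetric] sum_of_bool_eq)
  also have "\<dots> = (\<Sum>u\<in>UNIV. \<Sum>c\<in>UNIV. \<psi> (vdot u (c *s a)))"
    by (simp add: sum_scalar[symmetric] vdot_scale vdot_commute[of _ "_ *s _"] vdot_commute[of a])
  also have "\<dots> = (\<Sum>c\<in>UNIV. \<Sum>u\<in>UNIV. \<psi> (vdot u (c *s a)))" by (rule sum.swap)
  also have "\<dots> = (\<Sum>c\<in>UNIV. of_nat CARD('a ^ 'n) * of_bool ((c::'a) = 0))"
    using assms by (simp only: sum_vdot vector_mul_eq_0 simp_thms)
  also have "\<dots> = of_nat CARD('a ^ 'n)" by (simp add: sum_distrib_left[symmetric] sum_of_bool_eq)
  finally show ?thesis using of_nat_eq_iff by blast
qed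

text \<open>Unnormalised, so the number of matrices appears as a factor in the inversion and
  convolution formulas.\<close>

definition ft :: "real ^ ('a ^ 'm ^ 'd) \<Rightarrow> 'a ^ 'm::finite ^ 'd::finite \<Rightarrow> complex" where
  "ft v B = (\<Sum>z\<in>UNIV. of_real (v $ z) * \<psi> (- mdot B z))"

lemma ft_diff: "ft (v - w) B = ft v B - ft w B"
  by (simp add: ft_def sum_subtractf algebra_simps)

lemma ft_scaleR: "ft (c *\<^sub>R v) B = of_real c * ft v B"
  by (simp add: ft_def sum_distrib_left mult.assoc)

lemma ft_hat: "ft (hat x) B = \<psi> (- mdot B x)"
  by (simp add: ft_def axis_def if_distrib[of of_real] if_distrib[of "\<lambda>x. x * _"] cong: if_cong)

lemma ft_inversion:
  "(\<Sum>B\<in>UNIV. ft v B * \<psi> (mdot B z)) = of_nat CARD('a ^ 'm ^ 'd) * of_real (v $ z)"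
  for v :: "real ^ ('a ^ 'm::finite ^ 'd::finite)"
proof -
  have "(\<Sum>B\<in>UNIV. ft v B * \<psi> (mdot B z)) =
      (\<Sum>B\<in>UNIV. \<Sum>w\<in>UNIV. of_real (v $ w) * \<psi> (mdot B (z - w)))"
    unfolding ft_def sum_distrib_right mdot_diff_right diff by (simp add: ac_simps)
  also have "\<dots> = (\<Sum>w\<in>UNIV. \<Sum>B\<in>UNIV. of_real (v $ w) * \<psi> (mdot B (z - w)))"
    by (rule sum.swap)
  also have "\<dots> = (\<Sum>w\<in>UNIV. of_real (v $ w) * (of_nat CARD('a ^ 'm ^ 'd) * of_bool (z - w = 0)))"
    by (simp only: sum_distrib_left[symmetric] sum_mdot)
  also have "\<dots> = (\<Sum>w\<in>UNIV. if z = w then of_nat CARD('a ^ 'm ^ 'd) * of_real (v $ w) else 0)"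
    by (rule sum.cong) auto
  finally show ?thesis by simp
qed

lemma ft_inject: "(\<And>B. ft v B = ft w B) \<Longrightarrow> v = w"
proof -
  assume *: "\<And>B. ft v B = ft w B"
  have "complex_of_real (v $ z) = of_real (w $ z)" for z
    using ft_inversion[of v z] ft_inversion[of w z] by (simp add: *)
  then show "v = w" by (simp add: vec_eq_iff)
qed

text \<open>Replacing \<open>w $ z\<close> by its inversion formula turns the entrywise product into
  a convolution.\<close>

lemma ft_mult:
  "of_nat CARD('a ^ 'm ^ 'd) * ft (v * w) B = (\<Sum>C\<in>UNIV. ft v (B - C) * ft w C)"
  for v :: "real ^ ('a ^ 'm::finite ^ 'd::finite)"
proof -
  have "of_nat CARD('a ^ 'm ^ 'd) * ft (v * w) B =
      (\<Sum>z\<in>UNIV. of_real (v $ z) * \<psi> (- mdot B z) * (of_nat CARD('a ^ 'm ^ 'd) * of_real (w $ z)))"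
    by (simp add: ft_def sum_distrib_left ac_simps)
  also have "\<dots> = (\<Sum>z\<in>UNIV. \<Sum>C\<in>UNIV. of_real (v $ z) * \<psi> (- mdot (B - C) z) * ft w C)"
    by (simp only: ft_inversion[symmetric] sum_distrib_left)
      (simp add: mdot_diff_left add diff ac_simps)
  also have "\<dots> = (\<Sum>C\<in>UNIV. \<Sum>z\<in>UNIV. of_real (v $ z) * \<psi> (- mdot (B - C) z) * ft w C)"
    by (rule sum.swap)
  finally show ?thesis by (simp add: ft_def[of v] sum_distrib_right)
qed

end

section \<open>The spectrum of the bilinear forms graph\<close>

text \<open>The value of the character sum of frequency \<open>B\<close> over the rank-one matrices,
  see \<open>sum_rank_one\<close>. In this form it is visibly real and governed by the size of the
  left kernel alone.\<close>

definition char_eigenvalue :: "'a::{field,finite} ^ 'm::finite ^ 'd::finite \<Rightarrow> real" where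
  "char_eigenvalue B = (real CARD('a ^ 'm) * (real (card {u. u v* B = 0}) - 1)
     - (real CARD('a ^ 'd) - 1)) / (real CARD('a) - 1)"

lemma sum_Compl_singleton: "sum f (- {a}) = sum f UNIV - f a"
  for f :: "'v::finite \<Rightarrow> 'b::ab_group_add"
  by (simp add: Compl_eq_Diff_UNIV sum_diff1)

lemma vm_zero_right [simp]: "u v* (0 :: 'a::comm_semiring_1 ^ 'm ^ 'd::finite) = 0"
  by (simp add: vector_matrix_mult_def vec_eq_iff)

lemma vm_nth: "(u v* B) $ j = vdot u (column j B)"
  for B :: "'a::comm_semiring_1 ^ 'm ^ 'd::finite"
  by (simp add: vector_matrix_mult_def vdot_def column_def mult.commute)

lemma rank_one_nonempty: "\<exists>B. B \<in> (rank_one :: ('a::field ^ 'm::finite ^ 'd::finite) set)"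
proof -
  have "axis undefined 1 \<noteq> (0 :: 'a ^ 'd)" "axis undefined 1 \<noteq> (0 :: 'a ^ 'm)"
    by (metis axis_nth zero_index zero_neq_one)+
  then have "outer (axis undefined 1) (axis undefined 1) \<in> (rank_one :: ('a ^ 'm ^ 'd) set)"
    unfolding rank_one_def by blast
  then show ?thesis ..
qed

lemma sum_rank_one_uminus: "(\<Sum>C\<in>rank_one. f (- C)) = (\<Sum>C\<in>rank_one. f C)"
  by (rule sum.reindex_bij_witness[of _ uminus uminus]) (auto simp: rank_one_uminus)

lemma rank_one_diff_commute: "B - C \<in> rank_one \<longleftrightarrow> C - B \<in> rank_one"
  using rank_one_uminus[of "B - C"] by simp

lemma char_eigenvalue_uminus [simp]: "char_eigenvalue (- B) = char_eigenvalue B"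
proof -
  have "u v* - B = - (u v* B)" for u
    by (simp add: vector_matrix_mult_def vec_eq_iff sum_negf)
  then show ?thesis by (simp add: char_eigenvalue_def)
qed

lemma char_eigenvalue_less_iff:
  "char_eigenvalue B < char_eigenvalue C \<longleftrightarrow> card {u. u v* B = 0} < card {u. u v* C = 0}"
  for B C :: "'a::{field,finite} ^ 'm::finite ^ 'd::finite"
proof -
  have "real CARD('a) - 1 > 0" using CARD_field_ge_2[where 'a='a] by simp
  moreover have "real CARD('a ^ 'm) > 0" using zero_less_card_finite of_nat_0_less_iff by blast
  ultimately show ?thesis
    unfolding char_eigenvalue_def by (simp add: divide_less_cancel del: CARD_vec)
qed

context nontrivial_character
begin

lemma sum_rank_one: "(\<Sum>C\<in>rank_one. \<psi> (mdot B C)) = of_real (char_eigenvalue B)"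
  for B :: "'a ^ 'm::finite ^ 'd::finite"
proof -
  define M where "M = CARD('a ^ 'm)"
  define D where "D = CARD('a ^ 'd)"
  have q: "of_nat (CARD('a) - 1) = complex_of_real (real CARD('a) - 1)"
    using CARD_field_ge_2[where 'a='a] by (simp add: of_nat_diff)
  have "of_nat (CARD('a) - 1) * (\<Sum>C\<in>rank_one. \<psi> (mdot B C)) =
      (\<Sum>u\<in>-{0}. \<Sum>v\<in>-{0}. \<psi> (mdot B (outer u v)))"
    by (rule sum_outer_nonzero[symmetric])
  also have "\<dots> = (\<Sum>u\<in>-{0}. \<Sum>v\<in>-{0}. \<psi> (vdot v (u v* B)))"
    by (simp add: mdot_commute[of B] mdot_outer')
  \<comment> \<open>Orthogonality in \<open>v\<close>: the full sum is nonzero only for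
    \<open>u\<close> in the left kernel of \<open>B\<close>, and the omitted term
    \<open>v = 0\<close> contributes 1.\<close>
  also have "\<dots> = (\<Sum>u\<in>-{0}. of_nat M * of_bool (u v* B = 0) - 1)"
    by (simp only: sum_Compl_singleton sum_vdot M_def vdot_zero zero)
  also have "\<dots> = of_nat M * of_nat (card {u. u v* B = 0}) - of_nat D - (of_nat M - 1)"
    unfolding sum_Compl_singleton
    by (simp add: sum_subtractf sum_distrib_left[symmetric] sum_of_bool_eq D_def)
  also have "\<dots> = complex_of_real (real M * (real (card {u. u v* B = 0}) - 1) - (real D - 1))"
    by (simp add: algebra_simps)
  finally have "complex_of_real (real CARD('a) - 1) * (\<Sum>C\<in>rank_one. \<psi> (mdot B C)) =
      complex_of_real (real M * (real (card {u. u v* B = 0}) - 1) - (real D - 1))"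
    unfolding q .
  moreover have "complex_of_real (real CARD('a) - 1) \<noteq> 0"
    unfolding of_real_eq_0_iff using CARD_field_ge_2[where 'a='a] by simp
  ultimately have "(\<Sum>C\<in>rank_one. \<psi> (mdot B C)) =
      complex_of_real (real M * (real (card {u. u v* B = 0}) - 1) - (real D - 1)) /
      complex_of_real (real CARD('a) - 1)"
    by (metis nonzero_mult_div_cancel_left)
  then show ?thesis
    by (simp only: char_eigenvalue_def of_real_divide M_def D_def)
qed

text \<open>The graph is a Cayley graph of the additive group with connection set
  \<open>rank_one\<close>, so each character is an eigenvector.\<close>

lemma adj_char: "(\<Sum>w\<in>UNIV. of_bool (z - w \<in> rank_one) * \<psi> (mdot B w)) =
    \<psi> (mdot B z) * of_real (char_eigenvalue B)"
proof -
  have "(\<Sum>w\<in>UNIV. of_bool (z - w \<in> rank_one) * \<psi> (mdot B w)) =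
      (\<Sum>C\<in>UNIV. of_bool (C \<in> rank_one) * \<psi> (mdot B (z - C)))"
    by (rule sum.reindex_bij_witness[of _ "\<lambda>C. z - C" "\<lambda>w. z - w"]) auto
  also have "\<dots> = (\<Sum>C\<in>rank_one. \<psi> (mdot B z) * \<psi> (mdot B (- C)))"
    by (rule sum.mono_neutral_cong_right) (auto simp: mdot_diff_right mdot_minus_right diff)
  also have "\<dots> = \<psi> (mdot B z) * of_real (char_eigenvalue B)"
    using sum_rank_one_uminus[of "\<lambda>C. \<psi> (mdot B C)"]
    by (simp add: sum_distrib_left[symmetric] sum_rank_one)
  finally show ?thesis .
qed

lemma adj_matrix_mult_nth:
  "(adj_matrix bilin_adj *v v) $ z = (\<Sum>w\<in>UNIV. of_bool (z - w \<in> rank_one) * v $ w)"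
  by (simp add: adj_matrix_def matrix_vector_mult_def bilin_adj_iff of_bool_def)

lemma ft_adj: "ft (adj_matrix bilin_adj *v v) B = of_real (char_eigenvalue B) * ft v B"
proof -
  have "ft (adj_matrix bilin_adj *v v) B =
      (\<Sum>z\<in>UNIV. \<Sum>w\<in>UNIV. of_real (v $ w) * (of_bool (w - z \<in> rank_one) * \<psi> (mdot (- B) z)))"
    unfolding ft_def adj_matrix_mult_nth of_real_sum sum_distrib_right mdot_minus_left
    by (intro sum.cong refl) (subst rank_one_diff_commute, simp)
  also have "\<dots> =
      (\<Sum>w\<in>UNIV. \<Sum>z\<in>UNIV. of_real (v $ w) * (of_bool (w - z \<in> rank_one) * \<psi> (mdot (- B) z)))"
    by (rule sum.swap)
  also have "\<dots> = (\<Sum>w\<in>UNIV. of_real (v $ w) * (\<psi> (mdot (- B) w) * of_real (char_eigenvalue B)))"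
    by (simp only: sum_distrib_left[symmetric] adj_char char_eigenvalue_uminus)
  finally show ?thesis by (simp add: ft_def sum_distrib_left mdot_minus_left ac_simps)
qed

text \<open>The matrix and the eigenvalue are real, so the real part of a complex eigenvector
  satisfies the same equation.\<close>

lemma Re_char_eigenvector:
  "adj_matrix bilin_adj *v (\<chi> z. Re (\<psi> (mdot B z))) = char_eigenvalue B *\<^sub>R (\<chi> z. Re (\<psi> (mdot B z)))"
proof -
  have "(\<Sum>w\<in>UNIV. of_bool (z - w \<in> rank_one) * Re (\<psi> (mdot B w))) =
      Re (\<Sum>w\<in>UNIV. of_bool (z - w \<in> rank_one) * \<psi> (mdot B w))" for z
    unfolding Re_sum by (rule sum.cong) auto
  then show ?thesis by (simp add: vec_eq_iff adj_matrix_mult_nth adj_char)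
qed

lemma Im_char_eigenvector:
  "adj_matrix bilin_adj *v (\<chi> z. Im (\<psi> (mdot B z))) = char_eigenvalue B *\<^sub>R (\<chi> z. Im (\<psi> (mdot B z)))"
proof -
  have "(\<Sum>w\<in>UNIV. of_bool (z - w \<in> rank_one) * Im (\<psi> (mdot B w))) =
      Im (\<Sum>w\<in>UNIV. of_bool (z - w \<in> rank_one) * \<psi> (mdot B w))" for z
    unfolding Im_sum by (rule sum.cong) auto
  then show ?thesis by (simp add: vec_eq_iff adj_matrix_mult_nth adj_char)
qed

lemma eigenvalues_adj:
  "eigenvalues (adj_matrix (bilin_adj :: 'a ^ 'm::finite ^ 'd::finite \<Rightarrow> _)) = range (char_eigenvalue :: 'a ^ 'm ^ 'd \<Rightarrow> real)"
  (is "eigenvalues ?A = _")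
proof (intro equalityI subsetI)
  fix \<theta> assume "\<theta> \<in> eigenvalues ?A"
  then obtain v where v: "v \<noteq> 0" "?A *v v = \<theta> *\<^sub>R v" by (auto simp: eigenvalues_def)
  \<comment> \<open>A nonzero vector has a nonzero Fourier coefficient, and \<open>ft_adj\<close> at
    that frequency identifies the eigenvalue.\<close>
  obtain B where B: "ft v B \<noteq> ft 0 B" using ft_inject v(1) by blast
  then have "ft v B \<noteq> 0" by (simp add: ft_def)
  then have "\<theta> = char_eigenvalue B"
    using ft_adj[of v B] by (simp add: v(2) ft_scaleR)
  then show "\<theta> \<in> range (char_eigenvalue :: 'a ^ 'm ^ 'd \<Rightarrow> real)" by blast
next
  fix \<theta> assume "\<theta> \<in> range (char_eigenvalue :: 'a ^ 'm ^ 'd \<Rightarrow> real)"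
  then obtain B :: "'a ^ 'm ^ 'd" where B: "\<theta> = char_eigenvalue B" by blast
  \<comment> \<open>Every character takes the value 1 at the zero matrix, so its real part is a
    nonzero vector.\<close>
  have "(\<chi> z. Re (\<psi> (mdot B z))) $ 0 \<noteq> 0" by simp
  then have "(\<chi> z. Re (\<psi> (mdot B z))) \<noteq> 0" by (metis zero_index)
  then show "\<theta> \<in> eigenvalues ?A"
    using Re_char_eigenvector[of B] B by (auto simp: eigenvalues_def)
qed

section \<open>Sizes of left kernels and the order of the eigenvalues\<close>

lemma card_left_kernel_rank_one:
  fixes B :: "'a ^ 'm::finite ^ 'd::finite"
  assumes "B \<in> rank_one"
  shows "CARD('a) * card {u. u v* B = 0} = CARD('a ^ 'd)"
proof -
  obtain u v where "B = outer u v" "u \<noteq> 0" "v \<noteq> 0" using assms by (auto simp: rank_one_def)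
  then show ?thesis using card_hyperplane[of u] by (simp add: outer_vm del: CARD_vec)
qed

text \<open>The left kernel lies in the hyperplane orthogonal to a nonzero column; a second column
  that is not a multiple of the first makes the inclusion proper.\<close>

lemma card_left_kernel_less:
  fixes B :: "'a ^ 'm::finite ^ 'd::finite"
  assumes "B \<notin> rank_one" "B \<noteq> 0"
  shows "CARD('a) * card {u. u v* B = 0} < CARD('a ^ 'd)"
proof -
  obtain i j where "B $ i $ j \<noteq> 0" using assms(2) by (auto simp: vec_eq_iff)
  then have a: "column j B \<noteq> 0" by (auto simp: column_def vec_eq_iff)
  have "\<exists>k. \<forall>c. column k B \<noteq> c *s column j B"
  proof (rule ccontr)
    assume "\<nexists>k. \<forall>c. column k B \<noteq> c *s column j B"
    then obtain c where c: "\<And>k. column k B = c k *s column j B" by metis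
    have B: "B = outer (column j B) (\<chi> k. c k)"
    proof -
      have "B $ i $ k = outer (column j B) (\<chi> k. c k) $ i $ k" for i k
        using c[of k] by (simp add: outer_def column_def vec_eq_iff mult.commute)
      then show ?thesis unfolding vec_eq_iff by blast
    qed
    then have "(\<chi> k. c k) \<noteq> 0" using assms(2) outer_eq_0_iff by metis
    with B a assms(1) show False unfolding rank_one_def by blast
  qed
  then obtain k t where t: "vdot t (column j B) = 0" "vdot t (column k B) \<noteq> 0"
    using annihilator_not_subset by metis
  have "{u. u v* B = 0} \<subset> {u. vdot u (column j B) = 0}"
  proof
    show "{u. u v* B = 0} \<subseteq> {u. vdot u (column j B) = 0}"
      by (metis (mono_tags, lifting) mem_Collect_eq subsetI vm_nth zero_index)
    show "{u. u v* B = 0} \<noteq> {u. vdot u (column j B) = 0}"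
      using t by (metis (mono_tags, lifting) mem_Collect_eq vm_nth zero_index)
  qed
  then have "card {u. u v* B = 0} < card {u. vdot u (column j B) = 0}"
    by (intro psubset_card_mono) auto
  then show ?thesis
    unfolding card_hyperplane[OF a, symmetric] by simp
qed

lemma char_eigenvalue_rank_one_greater:
  fixes B C :: "'a ^ 'm::finite ^ 'd::finite"
  assumes "B \<in> rank_one" "C \<notin> rank_one" "C \<noteq> 0"
  shows "char_eigenvalue C < char_eigenvalue B"
proof -
  have "CARD('a) * card {u. u v* C = 0} < CARD('a) * card {u. u v* B = 0}"
    using card_left_kernel_less[OF assms(2,3)] card_left_kernel_rank_one[OF assms(1)] by simp
  then show ?thesis by (simp add: char_eigenvalue_less_iff)
qed

lemma char_eigenvalue_rank_one_eq:
  fixes B C :: "'a ^ 'm::finite ^ 'd::finite"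
  assumes "B \<in> rank_one" "C \<in> rank_one"
  shows "char_eigenvalue B = char_eigenvalue C"
proof -
  have "CARD('a) * card {u. u v* B = 0} = CARD('a) * card {u. u v* C = 0}"
    using card_left_kernel_rank_one assms by metis
  then show ?thesis by (simp add: char_eigenvalue_def)
qed

lemma char_eigenvalue_less_zero:
  fixes B :: "'a ^ 'm::finite ^ 'd::finite"
  assumes "B \<noteq> 0"
  shows "char_eigenvalue B < char_eigenvalue (0 :: 'a ^ 'm ^ 'd)"
proof -
  have "CARD('a) * card {u. u v* B = 0} \<le> CARD('a ^ 'd)"
    using card_left_kernel_less[OF _ assms] card_left_kernel_rank_one[of B] by fastforce
  also have "\<dots> < CARD('a) * CARD('a ^ 'd)"
    using CARD_field_ge_2[where 'a='a] zero_less_card_finite[where 'a="'a ^ 'd"] by simp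
  finally show ?thesis by (simp add: char_eigenvalue_less_iff del: CARD_vec)
qed

text \<open>Eigenvalues are ordered by left kernels: the whole space at 0, a hyperplane at rank one,
  smaller otherwise.\<close>

lemma second_largest_eigenvalue_adj:
  fixes B :: "'a ^ 'm::finite ^ 'd::finite"
  assumes B: "B \<in> rank_one"
  shows "second_largest_eigenvalue (adj_matrix (bilin_adj :: 'a ^ 'm ^ 'd \<Rightarrow> _)) = char_eigenvalue B"
proof -
  let ?e = "char_eigenvalue :: 'a ^ 'm ^ 'd \<Rightarrow> real"
  have "Max (range ?e) = ?e 0"
    by (rule Max_eqI) (auto, metis char_eigenvalue_less_zero less_imp_le order_refl)
  moreover have "Max (range ?e - {?e 0}) = ?e B"
  proof (rule Max_eqI)
    show "?e B \<in> range ?e - {?e 0}"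
      using char_eigenvalue_less_zero[of B] B zero_not_rank_one by fastforce
    fix y assume "y \<in> range ?e - {?e 0}"
    then obtain C where C: "y = ?e C" "C \<noteq> 0" by auto
    then show "y \<le> ?e B"
      using char_eigenvalue_rank_one_eq[OF _ B] char_eigenvalue_rank_one_greater[OF B]
      by (cases "C \<in> rank_one") (auto intro: less_imp_le)
  qed simp
  ultimately show ?thesis by (simp add: second_largest_eigenvalue_def eigenvalues_adj)
qed

lemma char_eigenvalue_eq_iff:
  fixes B C :: "'a ^ 'm::finite ^ 'd::finite"
  assumes B: "B \<in> rank_one"
  shows "char_eigenvalue C = char_eigenvalue B \<longleftrightarrow> C \<in> rank_one"
proof
  assume eq: "char_eigenvalue C = char_eigenvalue B"
  show "C \<in> rank_one"
  proof (rule ccontr)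
    assume C: "C \<notin> rank_one"
    have "B \<noteq> 0" using B zero_not_rank_one by blast
    then show False
      using char_eigenvalue_rank_one_greater[OF B C] char_eigenvalue_less_zero[of B] eq
      by (cases "C = 0") auto
  qed
next
  assume "C \<in> rank_one"
  then show "char_eigenvalue C = char_eigenvalue B" using char_eigenvalue_rank_one_eq B by blast
qed

lemma ft_bilin_E: "ft (bilin_E *v v) B = of_bool (B \<in> rank_one) * ft v B"
  for B :: "'a ^ 'm::finite ^ 'd::finite"
proof -
  let ?A = "adj_matrix (bilin_adj :: 'a ^ 'm ^ 'd \<Rightarrow> _)"
  obtain B0 :: "'a ^ 'm ^ 'd" where B0: "B0 \<in> rank_one" using rank_one_nonempty by blast
  define W where "W = eigenspace ?A (char_eigenvalue B0)"
  have E: "bilin_E = orth_proj W"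
    by (simp add: bilin_E_def second_largest_eigenvalue_adj[OF B0] W_def)
  have "subspace W"
    by (auto simp: W_def eigenspace_def subspace_def matrix_vector_right_distrib
        matrix_vector_mult_scaleR scaleR_add_right)
  note proj = orth_proj[OF this, of v, folded E]
  show ?thesis
  proof (cases "B \<in> rank_one")
    case False
    \<comment> \<open>The projection lies in the eigenspace, so by \<open>ft_adj\<close> its
      coefficients vanish at frequencies belonging to other eigenvalues.\<close>
    have "?A *v (bilin_E *v v) = char_eigenvalue B0 *\<^sub>R (bilin_E *v v)"
      using proj(1) by (simp add: W_def eigenspace_def)
    then have "char_eigenvalue B0 * ft (bilin_E *v v) B = char_eigenvalue B * ft (bilin_E *v v) B"
      using ft_adj[of "bilin_E *v v" B] by (simp add: ft_scaleR)
    then show ?thesis using char_eigenvalue_eq_iff[OF B0, of B] False by simp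
  next
    case True
    \<comment> \<open>\<open>ft\<close> at \<open>B\<close> pairs with the character of frequency
      \<open>- B\<close>. Its real and imaginary parts lie in \<open>W\<close>, hence are orthogonal
      to the residual \<open>v - bilin_E *v v\<close>.\<close>
    then have "- B \<in> rank_one" by (simp add: rank_one_uminus)
    then have "char_eigenvalue (- B) = char_eigenvalue B0" using char_eigenvalue_rank_one_eq B0 by blast
    then have "(\<chi> z. Re (\<psi> (mdot (- B) z))) \<in> W" "(\<chi> z. Im (\<psi> (mdot (- B) z))) \<in> W"
      using Re_char_eigenvector[of "- B"] Im_char_eigenvector[of "- B"]
      by (simp_all add: W_def eigenspace_def)
    then have "(\<chi> z. Re (\<psi> (mdot (- B) z))) \<bullet> (v - bilin_E *v v) = 0"
      and "(\<chi> z. Im (\<psi> (mdot (- B) z))) \<bullet> (v - bilin_E *v v) = 0"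
      using proj(2) by (auto simp: orthogonal_comp_def orthogonal_def)
    then have "ft (v - bilin_E *v v) B = 0"
      by (simp add: ft_def complex_eq_iff inner_vec_def mdot_minus_left mult.commute)
    then show ?thesis using True by (simp add: ft_diff)
  qed
qed

lemma ft_norton_hat:
  "of_nat CARD('a ^ 'm ^ 'd) * ft (norton bilin_E (bilin_E *v hat x) w) B =
    of_bool (B \<in> rank_one) *
      (\<Sum>C\<in>{C. B - C \<in> rank_one}. \<psi> (- mdot (B - C) x) * ft w C)"
  for B :: "'a ^ 'm::finite ^ 'd::finite"
proof -
  have "of_nat CARD('a ^ 'm ^ 'd) * ft (norton bilin_E (bilin_E *v hat x) w) B =
      of_bool (B \<in> rank_one) * (of_nat CARD('a ^ 'm ^ 'd) * ft ((bilin_E *v hat x) * w) B)"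
    by (simp add: norton_def ft_bilin_E)
  also have "\<dots> = of_bool (B \<in> rank_one) *
      (\<Sum>C\<in>UNIV. of_bool (B - C \<in> rank_one) * \<psi> (- mdot (B - C) x) * ft w C)"
    by (simp only: ft_mult ft_bilin_E ft_hat)
  also have "(\<Sum>C\<in>UNIV. of_bool (B - C \<in> rank_one) * \<psi> (- mdot (B - C) x) * ft w C) =
      (\<Sum>C\<in>{C. B - C \<in> rank_one}. \<psi> (- mdot (B - C) x) * ft w C)"
    by (rule sum.mono_neutral_cong_right) auto
  finally show ?thesis .
qed

end

section \<open>Norton products of two vertices\<close>

lemma sum_Compl_pair: "a \<noteq> b \<Longrightarrow> sum f (- {a, b}) = sum f UNIV - f a - f b"
  for f :: "'v::finite \<Rightarrow> 'b::ab_group_add"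
proof -
  assume "a \<noteq> b"
  have "sum f UNIV = sum f {a, b} + sum f (- {a, b})"
    using sum.subset_diff[of "{a, b}" UNIV f] by (simp add: Compl_eq_Diff_UNIV add.commute)
  with \<open>a \<noteq> b\<close> show ?thesis by (simp add: algebra_simps)
qed

text \<open>Inclusion-exclusion: by \<open>rank_one_diff_iff\<close> one family varies
  \<open>u\<close>, the other varies \<open>v\<close>, and they overlap in the multiples of
  \<open>outer u v\<close>. Completing the index sets adds \<open>f 0\<close> and
  \<open>f (outer u v)\<close> to each of the three sums, a net surplus of one each.\<close>

lemma sum_rank_one_decompositions:
  fixes u :: "'a::{field,finite} ^ 'd::finite" and v :: "'a ^ 'm::finite"
    and f :: "'a ^ 'm ^ 'd \<Rightarrow> 'b::ab_group_add"
  assumes u: "u \<noteq> 0" and v: "v \<noteq> 0"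
  shows "(\<Sum>C\<in>{C \<in> rank_one. outer u v - C \<in> rank_one}. f C) =
    (\<Sum>u'\<in>UNIV. f (outer u' v)) + (\<Sum>v'\<in>UNIV. f (outer u v'))
    - (\<Sum>c\<in>UNIV. f (outer (c *s u) v)) - f 0 - f (outer u v)"
proof -
  let ?I = "(\<lambda>u'. outer u' v) ` (- {0, u})" and ?J = "(\<lambda>v'. outer u v') ` (- {0, v})"
  have inj1: "inj (\<lambda>u'. outer u' v)"
  proof (rule injI)
    fix u1 u2 assume "outer u1 v = outer u2 v"
    then have "outer (u1 - u2) v = 0" by (simp add: outer_diff_left)
    then show "u1 = u2" using v by (simp add: outer_eq_0_iff)
  qed
  have inj2: "inj (\<lambda>v'. outer u v')"
  proof (rule injI)
    fix v1 v2 assume "outer u v1 = outer u v2"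
    then have "outer u (v1 - v2) = 0" by (simp add: outer_diff_right)
    then show "v1 = v2" using u by (simp add: outer_eq_0_iff)
  qed
  have inj3: "inj (\<lambda>c. outer (c *s u) v)"
    by (rule injI) (use u injD[OF inj1] in \<open>auto dest: injD[OF inj1]\<close>)
  have dec: "{C \<in> rank_one. outer u v - C \<in> rank_one} = ?I \<union> ?J"
    using rank_one_diff_iff[OF u v] by auto
  have int: "?I \<inter> ?J = (\<lambda>c. outer (c *s u) v) ` (- {0, 1})"
  proof (intro equalityI subsetI)
    fix C assume "C \<in> ?I \<inter> ?J"
    then obtain u' v' where C: "C = outer u' v" "u' \<noteq> u" "outer u' v = outer u v'" "v' \<noteq> 0"
      by auto
    then obtain c where "c \<noteq> 0" "u' = c *s u" using outer_eq_outerD u by metis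
    moreover from this C(2) have "c \<noteq> 1" by auto
    ultimately show "C \<in> (\<lambda>c. outer (c *s u) v) ` (- {0, 1})"
      using C(1) by (intro image_eqI[of _ _ c]) auto
  next
    fix C assume "C \<in> (\<lambda>c. outer (c *s u) v) ` (- {0, 1})"
    then obtain c where c: "C = outer (c *s u) v" "c \<noteq> 0" "c \<noteq> 1" by auto
    then have "c *s u \<in> - {0, u}" "c *s v \<in> - {0, v}"
      using u v vector_mul_rcancel[of c u 1] vector_mul_rcancel[of c v 1] by auto
    then show "C \<in> ?I \<inter> ?J" using c(1) outer_scale[of c u v] by blast
  qed
  have "sum f (?I \<union> ?J) = sum f ?I + sum f ?J - sum f (?I \<inter> ?J)"
    using sum.union_inter[of ?I ?J f] by (simp add: algebra_simps)
  also have "sum f ?I = (\<Sum>u'\<in>UNIV. f (outer u' v)) - f 0 - f (outer u v)"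
    using u by (subst sum.reindex)
      (simp_all add: inj_on_subset[OF inj1] sum_Compl_pair o_def outer_eq_0_iff[THEN iffD2])
  also have "sum f ?J = (\<Sum>v'\<in>UNIV. f (outer u v')) - f 0 - f (outer u v)"
    using v by (subst sum.reindex)
      (simp_all add: inj_on_subset[OF inj2] sum_Compl_pair o_def outer_eq_0_iff[THEN iffD2])
  also have "sum f (?I \<inter> ?J) = (\<Sum>c\<in>UNIV. f (outer (c *s u) v)) - f 0 - f (outer u v)"
    unfolding int by (subst sum.reindex)
      (simp_all add: inj_on_subset[OF inj3] sum_Compl_pair o_def outer_eq_0_iff[THEN iffD2])
  finally show ?thesis unfolding dec by (simp add: algebra_simps)
qed

text \<open>With \<open>transpose_mult_outer\<close>, lets conditions on the factors of a rank-one
  matrix be stated without choosing the factors.\<close>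

lemma outer_mult_transpose: "outer u v ** transpose d = outer u (d *v v)"
  for d :: "'a::field ^ 'm::finite ^ 'd::finite"
  by (simp add: vec_eq_iff matrix_matrix_mult_def transpose_def outer_def matrix_vector_mult_def
      sum_distrib_left ac_simps)

lemma transpose_mult_outer: "transpose d ** outer u v = outer (u v* d) v"
  for d :: "'a::field ^ 'm::finite ^ 'd::finite"
  by (simp add: vec_eq_iff matrix_matrix_mult_def transpose_def outer_def vector_matrix_mult_def
      sum_distrib_left sum_distrib_right ac_simps)

lemma sum_of_bool_disj:
  "(\<Sum>t\<in>UNIV. of_bool (t = a \<or> P)) = (1 + (of_nat CARD('v) - 1) * of_bool P :: complex)"
  for a :: "'v::finite"
  by (cases P) (simp_all add: sum_of_bool_eq)

section \<open>A family of functions closed under restricted convolution\<close>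

context nontrivial_character
begin

text \<open>Hyperplane and whole space are merged into one affine expression in
  \<open>of_bool (w = 0)\<close>, so that the sums below are again combinations of
  indicators.\<close>

lemma sum_hyperplane:
  "(\<Sum>t\<in>UNIV. of_bool (vdot t w = 0)) =
    complex_of_real (real CARD('a ^ 'n) / real CARD('a)) +
    (of_nat CARD('a ^ 'n) - complex_of_real (real CARD('a ^ 'n) / real CARD('a))) * of_bool (w = 0)"
  for w :: "'a ^ 'n::finite"
proof (cases "w = 0")
  case False
  have "real CARD('a) * real (card {t. vdot t w = 0}) = real CARD('a ^ 'n)"
    using card_hyperplane[OF False] by (metis of_nat_mult)
  then have "real (card {t. vdot t w = 0}) = real CARD('a ^ 'n) / real CARD('a)"
    by (simp add: field_simps)
  then have "complex_of_nat (card {t. vdot t w = 0}) = complex_of_real (real CARD('a ^ 'n) / real CARD('a))"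
    by (metis of_real_of_nat_eq)
  then show ?thesis using False by (simp add: sum_of_bool_eq del: CARD_vec)
qed (simp del: CARD_vec)

lemma sum_vdot_uminus:
  "(\<Sum>t\<in>UNIV. \<psi> (- vdot t w)) = of_nat CARD('a ^ 'n) * of_bool (w = 0)"
  for w :: "'a ^ 'n::finite"
proof -
  have "- vdot t w = vdot t (- w)" for t by (simp add: vdot_def sum_negf)
  then show ?thesis using sum_vdot[of "- w"] by (simp del: CARD_vec)
qed

lemma sum_scalar_uminus:
  "(\<Sum>c\<in>UNIV. \<psi> (- (c * a))) = of_nat CARD('a) * of_bool (a = 0)"
  using sum_scalar[of "- a"] by simp

text \<open>
  For \<open>B = outer u v\<close> the three conditions below read \<open>d v = 0\<close>,
  \<open>u\<^sup>T d = 0\<close> and \<open>u\<^sup>T d v = 0\<close>.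
\<close>

definition freq ::
  "'a ^ 'm::finite ^ 'd::finite \<Rightarrow> real \<Rightarrow> real \<Rightarrow> real \<Rightarrow> real \<Rightarrow> real \<Rightarrow> 'a ^ 'm ^ 'd \<Rightarrow> complex"
where
  "freq d a b r l h B = of_real a + of_real b * \<psi> (- mdot B d)
    + of_real r * of_bool (B ** transpose d = 0) + of_real l * of_bool (transpose d ** B = 0)
    + of_real h * of_bool (mdot B d = 0)"

text \<open>Summing the character over \<open>u'\<close>, over \<open>v'\<close> and over the
  multiples of \<open>B\<close> yields the indicators of \<open>d *v v = 0\<close>,
  \<open>u v* d = 0\<close> and \<open>mdot B d = 0\<close>. The indicators themselves sum to
  constants and multiples of indicators, so the family is closed. Here \<open>kl\<close> and
  \<open>kr\<close> are the kernel sizes of \<open>d\<close>, and \<open>h1\<close>,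
  \<open>h2\<close> are hyperplane sizes.\<close>

lemma sum_freq_explicit:
  fixes d B :: "'a ^ 'm::finite ^ 'd::finite"
  assumes B: "B \<in> rank_one"
    and kl: "kl = real (card {u. u v* d = 0})" and kr: "kr = real (card {v. d *v v = 0})"
    and n1: "n1 = real CARD('a ^ 'd)" and n2: "n2 = real CARD('a ^ 'm)" and q: "q = real CARD('a)"
    and h1: "h1 = n1 / q" and h2: "h2 = n2 / q"
  shows "(\<Sum>C\<in>{C \<in> rank_one. B - C \<in> rank_one}. freq d a b r l h C) =
    freq d (a * (n1 + n2 - q - 2) - b + r * (kr - 1) + l * (kl - 1) + h * (h1 + h2 - 2)) (- b)
      (b * n1 + r * (n1 - q - 1) + h * (n1 - h1)) (b * n2 + l * (n2 - q - 1) + h * (n2 - h2))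
      (- b * q - h * q) B"
proof -
  obtain u v where uv: "B = outer u v" "u \<noteq> 0" "v \<noteq> 0" using B by (auto simp: rank_one_def)
  define R L H where "R = (of_bool (d *v v = 0) :: complex)" and "L = (of_bool (u v* d = 0) :: complex)"
    and "H = (of_bool (mdot B d = 0) :: complex)"
  have n1': "of_nat CARD('a ^ 'd) = complex_of_real n1" by (simp add: n1 del: CARD_vec)
  have n2': "of_nat CARD('a ^ 'm) = complex_of_real n2" by (simp add: n2 del: CARD_vec)
  have q': "of_nat CARD('a) = complex_of_real q" by (simp add: q)
  have h1': "complex_of_real (real CARD('a ^ 'd) / real CARD('a)) = of_real h1"
    unfolding h1 n1 q ..
  have h2': "complex_of_real (real CARD('a ^ 'm) / real CARD('a)) = of_real h2"
    unfolding h2 n2 q ..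
  have kl': "(\<Sum>u\<in>UNIV. of_bool (u v* d = 0)) = complex_of_real kl"
    by (simp add: kl sum_of_bool_eq)
  have kr': "(\<Sum>v\<in>UNIV. of_bool (d *v v = 0)) = complex_of_real kr"
    by (simp add: kr sum_of_bool_eq)
  have c: "mdot B d = vdot u (d *v v)" by (simp add: uv mdot_outer)
  have 1: "(\<Sum>u'\<in>UNIV. freq d a b r l h (outer u' v)) =
      of_real n1 * of_real a + of_real b * (of_real n1 * R) + of_real r * (1 + (of_real n1 - 1) * R)
      + of_real l * of_real kl + of_real h * (of_real h1 + (of_real n1 - of_real h1) * R)"
  proof -
    have "freq d a b r l h (outer u' v) = of_real a + of_real b * \<psi> (- vdot u' (d *v v))
      + of_real r * of_bool (u' = 0 \<or> d *v v = 0) + of_real l * of_bool (u' v* d = 0)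
      + of_real h * of_bool (vdot u' (d *v v) = 0)" for u'
      using uv by (simp add: freq_def mdot_outer outer_mult_transpose transpose_mult_outer outer_eq_0_iff)
    then show ?thesis
      by (simp only: sum.distrib sum_distrib_left[symmetric] sum_constant sum_vdot_uminus
          sum_of_bool_disj sum_hyperplane kl' n1' h1' R_def)
  qed
  have 2: "(\<Sum>v'\<in>UNIV. freq d a b r l h (outer u v')) =
      of_real n2 * of_real a + of_real b * (of_real n2 * L) + of_real r * of_real kr
      + of_real l * (1 + (of_real n2 - 1) * L) + of_real h * (of_real h2 + (of_real n2 - of_real h2) * L)"
  proof -
    have "freq d a b r l h (outer u v') = of_real a + of_real b * \<psi> (- vdot v' (u v* d))
      + of_real r * of_bool (d *v v' = 0) + of_real l * of_bool (v' = 0 \<or> u v* d = 0)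
      + of_real h * of_bool (vdot v' (u v* d) = 0)" for v'
      using uv by (simp add: freq_def mdot_outer' outer_mult_transpose transpose_mult_outer outer_eq_0_iff
          disj_commute)
    then show ?thesis
      by (simp only: sum.distrib sum_distrib_left[symmetric] sum_constant sum_vdot_uminus
          sum_of_bool_disj sum_hyperplane kr' n2' h2' L_def)
  qed
  have 3: "(\<Sum>c\<in>UNIV. freq d a b r l h (outer (c *s u) v)) =
      of_real q * of_real a + of_real b * (of_real q * H) + of_real r * (1 + (of_real q - 1) * R)
      + of_real l * (1 + (of_real q - 1) * L) + of_real h * (1 + (of_real q - 1) * H)"
  proof -
    have "mdot (outer (c *s u) v) d = c * mdot B d" for c by (simp add: c mdot_outer vdot_scale)
    moreover have "(c *s u) v* d = c *s (u v* d)" for c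
      by (simp add: vm_nth vdot_scale vec_eq_iff)
    ultimately have "freq d a b r l h (outer (c *s u) v) = of_real a + of_real b * \<psi> (- (c * mdot B d))
      + of_real r * of_bool (c = 0 \<or> d *v v = 0) + of_real l * of_bool (c = 0 \<or> u v* d = 0)
      + of_real h * of_bool (c = 0 \<or> mdot B d = 0)" for c
      using uv by (simp add: freq_def outer_mult_transpose transpose_mult_outer outer_eq_0_iff)
    then show ?thesis
      by (simp only: sum.distrib sum_distrib_left[symmetric] sum_constant sum_scalar_uminus
          sum_of_bool_disj q' R_def L_def H_def)
  qed
  \<comment> \<open>At frequency 0 all conditions hold and the character is 1.\<close>
  have 4: "freq d a b r l h 0 = of_real (a + b + r + l + h)"
    by (simp add: freq_def matrix_matrix_mult_def vec_eq_iff)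
  have 5: "freq d a' b' r' l' h' B = of_real a' + of_real b' * \<psi> (- mdot B d)
    + of_real r' * R + of_real l' * L + of_real h' * H" for a' b' r' l' h'
    using uv by (simp add: freq_def outer_mult_transpose transpose_mult_outer outer_eq_0_iff R_def L_def H_def)
  have "(\<Sum>C\<in>{C \<in> rank_one. B - C \<in> rank_one}. freq d a b r l h C) =
    (\<Sum>u'\<in>UNIV. freq d a b r l h (outer u' v)) + (\<Sum>v'\<in>UNIV. freq d a b r l h (outer u v'))
    - (\<Sum>c\<in>UNIV. freq d a b r l h (outer (c *s u) v)) - freq d a b r l h 0 - freq d a b r l h B"
    unfolding uv(1) by (rule sum_rank_one_decompositions[OF uv(2,3)])
  also have "\<dots> = freq d (a * (n1 + n2 - q - 2) - b + r * (kr - 1) + l * (kl - 1) + h * (h1 + h2 - 2)) (- b)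
      (b * n1 + r * (n1 - q - 1) + h * (n1 - h1)) (b * n2 + l * (n2 - q - 1) + h * (n2 - h2))
      (- b * q - h * q) B"
    unfolding 1 2 3 4 5 by (simp add: algebra_simps)
  finally show ?thesis .
qed

text \<open>The same coefficients serve \<open>d\<close> and \<open>- d\<close>, so that they are respected by exchanging \<open>x\<close> and \<open>y\<close>.\<close>

lemma sum_freq:
  fixes d :: "'a ^ 'm::finite ^ 'd::finite"
  shows "\<exists>a' b' r' l' h'. \<forall>d'\<in>{d, - d}. \<forall>B\<in>rank_one.
    (\<Sum>C\<in>{C \<in> rank_one. B - C \<in> rank_one}. freq d' a b r l h C) = freq d' a' b' r' l' h' B"
proof -
  \<comment> \<open>The explicit coefficients involve \<open>d\<close> only through its two kernel
    sizes.\<close>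
  have "{u. u v* - d = 0} = {u. u v* d = 0}"
    by (simp add: vector_matrix_mult_def vec_eq_iff sum_negf)
  moreover have "{v. - d *v v = 0} = {v. d *v v = 0}"
    by (simp add: matrix_vector_mult_def vec_eq_iff sum_negf)
  ultimately have "\<forall>d'\<in>{d, - d}. card {u. u v* d' = 0} = card {u. u v* d = 0} \<and>
      card {v. d' *v v = 0} = card {v. d *v v = 0}" by simp
  then show ?thesis
    using sum_freq_explicit[OF _ refl refl refl refl refl refl refl, of _ _ a b r l h] by fastforce
qed

text \<open>For \<open>r = l = h = 0\<close> this is the transform of \<open>a\<close> times E x
  plus \<open>b\<close> times E y, because
  \<open>\<psi> (- mdot B x) * \<psi> (- mdot B (y - x))\<close> equals
  \<open>\<psi> (- mdot B y)\<close>.\<close>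

definition pair_ft ::
  "'a ^ 'm::finite ^ 'd::finite \<Rightarrow> 'a ^ 'm ^ 'd \<Rightarrow> real \<Rightarrow> real \<Rightarrow> real \<Rightarrow> real \<Rightarrow> real \<Rightarrow> 'a ^ 'm ^ 'd \<Rightarrow> complex"
where
  "pair_ft x y a b r l h B = of_bool (B \<in> rank_one) * (\<psi> (- mdot B x) * freq (y - x) a b r l h B)"

text \<open>All three indicators are supported where \<open>mdot B (y - x) = 0\<close>, and there
  the phases of \<open>x\<close> and \<open>y\<close> agree. Changing the base point therefore only
  exchanges the first two functions.\<close>

lemma pair_ft_swap: "pair_ft y x b a r l h B = pair_ft x y a b r l h B"
proof (cases "B \<in> rank_one")
  case True
  then obtain u v where uv: "B = outer u v" "u \<noteq> 0" "v \<noteq> 0" by (auto simp: rank_one_def)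
  have yx: "\<psi> (- mdot B y) = \<psi> (- mdot B x) * \<psi> (- mdot B (y - x))"
    using add[of "- mdot B x" "- mdot B (y - x)"] by (simp add: mdot_diff_right)
  have xy: "\<psi> (- mdot B x) = \<psi> (- mdot B y) * \<psi> (- mdot B (x - y))"
    using add[of "- mdot B y" "- mdot B (x - y)"] by (simp add: mdot_diff_right)
  have c: "mdot B (x - y) = 0 \<longleftrightarrow> mdot B (y - x) = 0"
    by (auto simp: mdot_diff_right)
  have "(x - y) *v v = - ((y - x) *v v)" "u v* (x - y) = - (u v* (y - x))"
    by (simp_all add: matrix_vector_mult_def vector_matrix_mult_def vec_eq_iff sum_negf[symmetric] algebra_simps)
  then have r: "B ** transpose (x - y) = 0 \<longleftrightarrow> B ** transpose (y - x) = 0"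
    and l: "transpose (x - y) ** B = 0 \<longleftrightarrow> transpose (y - x) ** B = 0"
    using uv by (simp_all add: outer_mult_transpose transpose_mult_outer outer_eq_0_iff)
  have r0: "mdot B (y - x) = 0" if "B ** transpose (y - x) = 0"
    using that uv by (simp add: outer_mult_transpose outer_eq_0_iff mdot_outer)
  have l0: "mdot B (y - x) = 0" if "transpose (y - x) ** B = 0"
    using that uv by (simp add: transpose_mult_outer outer_eq_0_iff mdot_outer')
  show ?thesis
  proof (cases "mdot B (y - x) = 0")
    case True
    then have "\<psi> (- mdot B y) = \<psi> (- mdot B x)" using yx by simp
    then show ?thesis using True c r l by (simp add: pair_ft_def freq_def)
  next
    case False
    have "pair_ft y x b a r l h B =
        of_real b * \<psi> (- mdot B y) + of_real a * (\<psi> (- mdot B y) * \<psi> (- mdot B (x - y)))"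
      using False \<open>B \<in> rank_one\<close> c r l r0 l0 by (auto simp: pair_ft_def freq_def algebra_simps)
    also have "\<dots> = of_real b * (\<psi> (- mdot B x) * \<psi> (- mdot B (y - x))) + of_real a * \<psi> (- mdot B x)"
      by (simp only: xy[symmetric] yx[symmetric])
    also have "\<dots> = pair_ft x y a b r l h B"
      using False \<open>B \<in> rank_one\<close> r0 l0 by (auto simp: pair_ft_def freq_def algebra_simps)
    finally show ?thesis .
  qed
qed (simp add: pair_ft_def)

text \<open>The phases at \<open>B - C\<close> and \<open>C\<close> combine to the phase at
  \<open>B\<close>, which leaves the sum in \<open>s\<close>; \<open>k\<close> undoes the
  normalisation of the convolution.\<close>

lemma ft_norton_hat_pair:
  fixes x y :: "'a ^ 'm::finite ^ 'd::finite"
  assumes w: "\<And>C. ft w C = pair_ft x y a b r l h C"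
    and s: "\<And>B. B \<in> rank_one \<Longrightarrow>
      (\<Sum>C\<in>{C \<in> rank_one. B - C \<in> rank_one}. freq (y - x) a b r l h C) = freq (y - x) a' b' r' l' h' B"
  defines "k \<equiv> 1 / real CARD('a ^ 'm ^ 'd)"
  shows "ft (norton bilin_E (bilin_E *v hat x) w) B = pair_ft x y (k * a') (k * b') (k * r') (k * l') (k * h') B"
proof -
  let ?X = "of_nat CARD('a ^ 'm ^ 'd) :: complex"
  have "?X \<noteq> 0" using zero_less_card_finite[where 'a="'a ^ 'm ^ 'd"] of_nat_eq_0_iff by (metis less_irrefl)
  have sc: "freq d (k * a') (k * b') (k * r') (k * l') (k * h') B = freq d a' b' r' l' h' B / ?X" for d
    by (simp add: freq_def k_def divide_inverse algebra_simps del: CARD_vec)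
  have "(\<Sum>C\<in>{C. B - C \<in> rank_one}. \<psi> (- mdot (B - C) x) * ft w C) =
      (\<Sum>C\<in>{C \<in> rank_one. B - C \<in> rank_one}. \<psi> (- mdot B x) * freq (y - x) a b r l h C)"
  proof (rule sum.mono_neutral_cong_right)
    fix C assume "C \<in> {C \<in> rank_one. B - C \<in> rank_one}"
    moreover have "\<psi> (- mdot (B - C) x) * \<psi> (- mdot C x) = \<psi> (- mdot B x)"
      unfolding add[symmetric] by (simp add: mdot_diff_left)
    ultimately show "\<psi> (- mdot (B - C) x) * ft w C = \<psi> (- mdot B x) * freq (y - x) a b r l h C"
      by (simp add: w pair_ft_def mult.assoc[symmetric])
  qed (auto simp: w pair_ft_def)
  then have "?X * ft (norton bilin_E (bilin_E *v hat x) w) B =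
      of_bool (B \<in> rank_one) * (\<psi> (- mdot B x) * freq (y - x) a' b' r' l' h' B)"
    by (simp only: ft_norton_hat sum_distrib_left[symmetric]) (simp add: s)
  then show ?thesis
    using \<open>?X \<noteq> 0\<close> unfolding pair_ft_def sc by (simp add: field_simps del: CARD_vec)
qed

text \<open>The second claim is the first with \<open>x\<close> and \<open>y\<close> exchanged. The
  new coefficients are the same because \<open>sum_freq\<close> treats \<open>y - x\<close> and its
  negative alike.\<close>

lemma norton_step:
  fixes x y :: "'a ^ 'm::finite ^ 'd::finite"
  obtains a' b' r' l' h' where
    "\<And>w B. (\<And>C. ft w C = pair_ft x y a b r l h C) \<Longrightarrow>
      ft (norton bilin_E (bilin_E *v hat x) w) B = pair_ft x y a' b' r' l' h' B"
    "\<And>w B. (\<And>C. ft w C = pair_ft x y b a r l h C) \<Longrightarrow>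
      ft (norton bilin_E (bilin_E *v hat y) w) B = pair_ft x y b' a' r' l' h' B"
proof -
  obtain a' b' r' l' h' where s: "\<And>d' B. d' \<in> {y - x, - (y - x)} \<Longrightarrow> B \<in> rank_one \<Longrightarrow>
    (\<Sum>C\<in>{C \<in> rank_one. B - C \<in> rank_one}. freq d' a b r l h C) = freq d' a' b' r' l' h' B"
    using sum_freq[of "y - x" a b r l h] by blast
  note 1 = s[of "y - x", simplified] and 2 = s[of "x - y", simplified]
  show thesis
  proof (rule that)
    fix w B assume "\<And>C. ft w C = pair_ft x y a b r l h C"
    from ft_norton_hat_pair[OF this 1]
    show "ft (norton bilin_E (bilin_E *v hat x) w) B =
      pair_ft x y (1 / real CARD('a ^ 'm ^ 'd) * a') (1 / real CARD('a ^ 'm ^ 'd) * b')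
        (1 / real CARD('a ^ 'm ^ 'd) * r') (1 / real CARD('a ^ 'm ^ 'd) * l') (1 / real CARD('a ^ 'm ^ 'd) * h') B"
      by simp
  next
    fix w B assume "\<And>C. ft w C = pair_ft x y b a r l h C"
    then have "\<And>C. ft w C = pair_ft y x a b r l h C" by (simp only: pair_ft_swap)
    from ft_norton_hat_pair[OF this 2]
    show "ft (norton bilin_E (bilin_E *v hat y) w) B =
      pair_ft x y (1 / real CARD('a ^ 'm ^ 'd) * b') (1 / real CARD('a ^ 'm ^ 'd) * a')
        (1 / real CARD('a ^ 'm ^ 'd) * r') (1 / real CARD('a ^ 'm ^ 'd) * l') (1 / real CARD('a ^ 'm ^ 'd) * h') B"
      by (simp add: pair_ft_swap)
  qed
qed

lemma ft_bilin_E_hat: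
  "ft (bilin_E *v hat x) B = pair_ft x y 1 0 0 0 0 B"
  "ft (bilin_E *v hat y) B = pair_ft x y 0 1 0 0 0 B"
proof -
  show *: "ft (bilin_E *v hat x) B = pair_ft x y 1 0 0 0 0 B" for x y
    by (simp add: ft_bilin_E ft_hat pair_ft_def freq_def)
  show "ft (bilin_E *v hat y) B = pair_ft x y 0 1 0 0 0 B"
    using *[of y x] by (simp only: pair_ft_swap)
qed

text \<open>Invariant of the nested product: the two partial products have coefficients that differ
  only by exchanging \<open>a\<close> and \<open>b\<close>.\<close>

lemma norton_foldr_pair:
  fixes x y :: "'a ^ 'm::finite ^ 'd::finite"
  assumes "{s, s'} = {x, y}" "\<And>i. i \<in> set is \<Longrightarrow> {z i, z' i} = {x, y}"
  shows "\<exists>a b r l h. \<forall>B.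
    ft (foldr (\<lambda>i. norton bilin_E (bilin_E *v hat (z i))) is (bilin_E *v hat s)) B = pair_ft x y a b r l h B \<and>
    ft (foldr (\<lambda>i. norton bilin_E (bilin_E *v hat (z' i))) is (bilin_E *v hat s')) B = pair_ft x y b a r l h B"
  using assms(2)
proof (induction "is")
  case Nil
  from assms(1) consider "s = x" "s' = y" | "s = y" "s' = x" by (auto simp: doubleton_eq_iff)
  then show ?case
    by cases (simp_all, metis ft_bilin_E_hat, metis ft_bilin_E_hat)
next
  case (Cons i "is")
  let ?w = "foldr (\<lambda>i. norton bilin_E (bilin_E *v hat (z i))) is (bilin_E *v hat s)"
    and ?w' = "foldr (\<lambda>i. norton bilin_E (bilin_E *v hat (z' i))) is (bilin_E *v hat s')"
  obtain a b r l h where w: "\<And>B. ft ?w B = pair_ft x y a b r l h B"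
    and w': "\<And>B. ft ?w' B = pair_ft x y b a r l h B"
    using Cons by (metis list.set_intros(2))
  from Cons.prems[of i] consider "z i = x" "z' i = y" | "z i = y" "z' i = x"
    by (auto simp: doubleton_eq_iff)
  then show ?case
  proof cases
    case 1
    obtain a' b' r' l' h' where step:
      "\<And>w B. (\<And>C. ft w C = pair_ft x y a b r l h C) \<Longrightarrow>
        ft (norton bilin_E (bilin_E *v hat x) w) B = pair_ft x y a' b' r' l' h' B"
      "\<And>w B. (\<And>C. ft w C = pair_ft x y b a r l h C) \<Longrightarrow>
        ft (norton bilin_E (bilin_E *v hat y) w) B = pair_ft x y b' a' r' l' h' B"
      using norton_step[of x y a b r l h] by blast
    show ?thesis
      unfolding foldr.simps o_apply 1
      by (intro exI allI conjI, rule step(1)[OF w], rule step(2)[OF w'])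
  next
    case 2
    \<comment> \<open>The first product is now multiplied by E y and the second by E x, so
      \<open>norton_step\<close> is taken with \<open>a\<close> and \<open>b\<close>
      exchanged.\<close>
    obtain a' b' r' l' h' where step:
      "\<And>w B. (\<And>C. ft w C = pair_ft x y b a r l h C) \<Longrightarrow>
        ft (norton bilin_E (bilin_E *v hat x) w) B = pair_ft x y a' b' r' l' h' B"
      "\<And>w B. (\<And>C. ft w C = pair_ft x y a b r l h C) \<Longrightarrow>
        ft (norton bilin_E (bilin_E *v hat y) w) B = pair_ft x y b' a' r' l' h' B"
      using norton_step[of x y b a r l h] by blast
    show ?thesis
      unfolding foldr.simps o_apply 2
      by (intro exI allI conjI, rule step(2)[OF w], rule step(1)[OF w'])
  qed
qed

lemma norton_nested_diff:
  fixes x y :: "'a ^ 'm::finite ^ 'd::finite"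
  assumes "n \<ge> 1" "\<And>i. 1 \<le> i \<Longrightarrow> i \<le> n \<Longrightarrow> {z i, z' i} = {x, y}"
  shows "norton_nested bilin_E z n - norton_nested bilin_E z' n
           \<in> span {bilin_E *v hat x - bilin_E *v hat y}"
proof -
  \<comment> \<open>Index n is the seed of the fold, and the list stops at n - 1.\<close>
  have "{z n, z' n} = {x, y}" "\<And>i. i \<in> set [1..<n] \<Longrightarrow> {z i, z' i} = {x, y}"
    using assms by simp_all
  from norton_foldr_pair[of "z n" "z' n" x y "[1..<n]" z z', OF this]
  obtain a b r l h where w: "\<And>B. ft (norton_nested bilin_E z n) B = pair_ft x y a b r l h B"
    "\<And>B. ft (norton_nested bilin_E z' n) B = pair_ft x y b a r l h B"
    unfolding norton_nested_def by blast
  \<comment> \<open>The indicator terms have equal coefficients and cancel in the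
    difference.\<close>
  have "norton_nested bilin_E z n - norton_nested bilin_E z' n =
      (a - b) *\<^sub>R (bilin_E *v hat x - bilin_E *v hat y)"
  proof (rule ft_inject)
    fix B
    show "ft (norton_nested bilin_E z n - norton_nested bilin_E z' n) B =
        ft ((a - b) *\<^sub>R (bilin_E *v hat x - bilin_E *v hat y)) B"
      unfolding ft_diff ft_scaleR w ft_bilin_E_hat[of x B y] ft_bilin_E_hat(2)[of y B x]
      by (simp add: pair_ft_def freq_def algebra_simps)
  qed
  then show ?thesis by (simp add: span_base span_scale)
qed

end

theorem theorem12p17:
  fixes q D N n :: nat
    and x y :: "'a::{field,finite} ^ 'm::finite ^ 'd::finite"
    and z z' :: "nat \<Rightarrow> 'a ^ 'm ^ 'd"
  assumes "CARD('a) = q" and "q \<noteq> 2"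
    and "CARD('d) = D" and "CARD('m) = N - D"
    and "N > 2 * D" and "2 * D \<ge> 6"
    and "2 \<le> graph_dist bilin_adj x y" and "graph_dist bilin_adj x y \<le> D - 1"
    and "n \<ge> 1"
    and "\<And>i. 1 \<le> i \<Longrightarrow> i \<le> n \<Longrightarrow> {z i, z' i} = {x, y}"
  shows "norton_nested bilin_E z n - norton_nested bilin_E z' n
           \<in> span {bilin_E *v hat x - bilin_E *v hat y}"
proof -
  obtain \<psi> :: "'a \<Rightarrow> complex" where "nontrivial_character \<psi>"
    using nontrivial_additive_character unfolding nontrivial_character_def by metis
  then show ?thesis
    using assms(9,10) by (rule nontrivial_character.norton_nested_diff)
qed

end
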